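(* Let $R$ be an associative ring and let $D$ be a retract of a differential $R$-module $F$ that admits a projective flag. If $D$ is acyclic, then $D$ is contractible.
   Context: Modules are left modules. A differential $R$-module is an $R$-module $D$ with an $R$-linear map $\delta^D\colon D\to D$, $(\delta^D)^2=0$; morphisms are $R$-linear maps commuting with the differentiations. $D$ is a retract of $F$ if it is a direct summand of $F$ in the category of differential $R$-modules. The homology is $H(D)=\operatorname{Ker}(\delta^D)/\operatorname{Im}(\delta^D)$, and $D$ is acyclic if $H(D)=0$. $D$ is contractible if it is isomorphic, as a differential module, to $(C\oplus C,\delta)$ with $\delta(c',c'')=(c'',0)$ for some $R$-module $C$. A differential flag in $F$ is a family $\{F^n\}_{n\in\mathbb Z}$ of $R$-submodules with $F^n\subseteq F^{n+1}$, $F^{-1}=0$, $\bigcup_n F^n=F$ and $\delta^F(F^n)\subseteq F^{n-1}$ for all $n\in\mathbb Z$. It is a projective flag if each $F^n/F^{n-1}$ is a projective $R$-module. (The flag is not required to be finite.) *)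

theory Defs
  imports "HOL-Algebra.Module" "HOL-Algebra.AbelCoset"
begin

section \<open>Left modules over an associative ring\<close>

text \<open>The locale \<open>module\<close> of HOL-Algebra requires a commutative ring of scalars, so left modules
  over an associative unital ring are introduced here, with the same record type and the same
  axioms. The record fields \<open>mult\<close> and \<open>one\<close> of a module carry no meaning and are never used.
  The predicate \<open>submodule\<close> of HOL-Algebra does not assume commutativity and is used as it is.\<close>

locale left_module = R?: ring R + M?: abelian_group M for R (structure) and M (structure) +
  assumes smult_closed [simp, intro]:
      "\<lbrakk>a \<in> carrier R; x \<in> carrier M\<rbrakk> \<Longrightarrow> a \<odot>\<^bsub>M\<^esub> x \<in> carrier M"
    and smult_l_distr:
      "\<lbrakk>a \<in> carrier R; b \<in> carrier R; x \<in> carrier M\<rbrakk> \<Longrightarrow>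
        (a \<oplus> b) \<odot>\<^bsub>M\<^esub> x = a \<odot>\<^bsub>M\<^esub> x \<oplus>\<^bsub>M\<^esub> b \<odot>\<^bsub>M\<^esub> x"
    and smult_r_distr:
      "\<lbrakk>a \<in> carrier R; x \<in> carrier M; y \<in> carrier M\<rbrakk> \<Longrightarrow>
        a \<odot>\<^bsub>M\<^esub> (x \<oplus>\<^bsub>M\<^esub> y) = a \<odot>\<^bsub>M\<^esub> x \<oplus>\<^bsub>M\<^esub> a \<odot>\<^bsub>M\<^esub> y"
    and smult_assoc1:
      "\<lbrakk>a \<in> carrier R; b \<in> carrier R; x \<in> carrier M\<rbrakk> \<Longrightarrow>
        (a \<otimes> b) \<odot>\<^bsub>M\<^esub> x = a \<odot>\<^bsub>M\<^esub> (b \<odot>\<^bsub>M\<^esub> x)"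
    and smult_one [simp]:
      "x \<in> carrier M \<Longrightarrow> \<one> \<odot>\<^bsub>M\<^esub> x = x"

definition module_hom ::
    "('a, 'r) ring_scheme \<Rightarrow> ('a, 'b, 'm) module_scheme \<Rightarrow> ('a, 'c, 'n) module_scheme \<Rightarrow> ('b \<Rightarrow> 'c) set"
  where "module_hom R M N =
    {h \<in> carrier M \<rightarrow> carrier N.
      (\<forall>x\<in>carrier M. \<forall>y\<in>carrier M. h (x \<oplus>\<^bsub>M\<^esub> y) = h x \<oplus>\<^bsub>N\<^esub> h y) \<and>
      (\<forall>a\<in>carrier R. \<forall>x\<in>carrier M. h (a \<odot>\<^bsub>M\<^esub> x) = a \<odot>\<^bsub>N\<^esub> h x)}"

text \<open>The quotient by a submodule \<open>N\<close>. Elements are cosets, and \<open>a \<odot> (N + x)\<close> is the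
  coset \<open>N + a \<odot> x\<close>, here obtained as \<open>N + a \<odot> X\<close> for the coset \<open>X = N + x\<close>.\<close>

definition quotient_module ::
    "('a, 'b, 'm) module_scheme \<Rightarrow> 'b set \<Rightarrow> ('a, 'b set) module"
  where "quotient_module M N =
    \<lparr>carrier = a_rcosets\<^bsub>M\<^esub> N, mult = undefined, one = undefined,
     zero = N, add = (\<lambda>X Y. X <+>\<^bsub>M\<^esub> Y),
     smult = (\<lambda>a X. N <+>\<^bsub>M\<^esub> ((\<lambda>x. a \<odot>\<^bsub>M\<^esub> x) ` X))\<rparr>"

definition module_sum ::
    "('a, 'b, 'm) module_scheme \<Rightarrow> ('a, 'c, 'n) module_scheme \<Rightarrow> ('a, 'b \<times> 'c) module"
  where "module_sum M N =
    \<lparr>carrier = carrier M \<times> carrier N, mult = undefined, one = undefined,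
     zero = (\<zero>\<^bsub>M\<^esub>, \<zero>\<^bsub>N\<^esub>),
     add = (\<lambda>(x, y) (x', y'). (x \<oplus>\<^bsub>M\<^esub> x', y \<oplus>\<^bsub>N\<^esub> y')),
     smult = (\<lambda>a (x, y). (a \<odot>\<^bsub>M\<^esub> x, a \<odot>\<^bsub>N\<^esub> y))\<rparr>"

text \<open>Projectivity is the lifting property along surjections. A definition in HOL cannot quantify
  over the types carrying the test modules, so they are taken in two types that are large enough:
  lemma \<open>projective_lift\<close> below derives the lifting property for test modules carried by
  arbitrary types.\<close>

definition projective_module ::
    "('a, 'r) ring_scheme \<Rightarrow> ('a, 'b, 'm) module_scheme \<Rightarrow> bool"
  where "projective_module R P \<longleftrightarrow>
    left_module R P \<and>
    (\<forall>(M :: ('a, 'b \<Rightarrow> 'a) module) (N :: ('a, 'b) module) g f.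
      left_module R M \<longrightarrow> left_module R N \<longrightarrow>
      g \<in> module_hom R M N \<longrightarrow> g ` carrier M = carrier N \<longrightarrow> f \<in> module_hom R P N \<longrightarrow>
      (\<exists>h \<in> module_hom R P M. \<forall>x\<in>carrier P. g (h x) = f x))"


section \<open>Differential modules\<close>

record ('a, 'b) diff_module = "('a, 'b) module" +
  diff :: "'b \<Rightarrow> 'b"

locale differential_module = left_module R D
  for R (structure) and D :: "('a, 'b, 'd) diff_module_scheme" (structure) +
  assumes diff_hom: "diff D \<in> module_hom R D D"
    and diff_diff: "x \<in> carrier D \<Longrightarrow> diff D (diff D x) = \<zero>\<^bsub>D\<^esub>"

definition diff_module_hom ::
    "('a, 'r) ring_scheme \<Rightarrow> ('a, 'b, 'd) diff_module_scheme \<Rightarrow> ('a, 'c, 'e) diff_module_scheme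
      \<Rightarrow> ('b \<Rightarrow> 'c) set"
  where "diff_module_hom R D E =
    {h \<in> module_hom R D E. \<forall>x\<in>carrier D. h (diff D x) = diff E (h x)}"

definition diff_isomorphic ::
    "('a, 'r) ring_scheme \<Rightarrow> ('a, 'b, 'd) diff_module_scheme \<Rightarrow> ('a, 'c, 'e) diff_module_scheme \<Rightarrow> bool"
  where "diff_isomorphic R D E \<longleftrightarrow>
    (\<exists>h \<in> diff_module_hom R D E. bij_betw h (carrier D) (carrier E))"

definition with_diff :: "('a, 'b) module \<Rightarrow> ('b \<Rightarrow> 'b) \<Rightarrow> ('a, 'b) diff_module"
  where "with_diff M d =
    \<lparr>carrier = carrier M, mult = mult M, one = one M, zero = zero M, add = add M,
     smult = smult M, diff = d\<rparr>"

definition diff_module_sum ::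
    "('a, 'b, 'd) diff_module_scheme \<Rightarrow> ('a, 'c, 'e) diff_module_scheme \<Rightarrow> ('a, 'b \<times> 'c) diff_module"
  where "diff_module_sum D E =
    with_diff (module_sum D E) (\<lambda>(x, y). (diff D x, diff E y))"

text \<open>The complement \<open>E\<close> is isomorphic to a submodule of \<open>F\<close>, hence can be carried by the type
  of \<open>F\<close>; see lemma \<open>retractI\<close> below.\<close>

definition retract_of ::
    "('a, 'r) ring_scheme \<Rightarrow> ('a, 'b, 'd) diff_module_scheme \<Rightarrow> ('a, 'c, 'f) diff_module_scheme \<Rightarrow> bool"
  where "retract_of R D F \<longleftrightarrow>
    (\<exists>E :: ('a, 'c) diff_module.
      differential_module R E \<and> diff_isomorphic R F (diff_module_sum D E))"

definition homology :: "('a, 'b, 'd) diff_module_scheme \<Rightarrow> ('a, 'b set) module"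
  where "homology D =
    quotient_module (D\<lparr>carrier := {x \<in> carrier D. diff D x = \<zero>\<^bsub>D\<^esub>}\<rparr>) (diff D ` carrier D)"

definition acyclic_module :: "('a, 'b, 'd) diff_module_scheme \<Rightarrow> bool"
  where "acyclic_module D \<longleftrightarrow> carrier (homology D) = {\<zero>\<^bsub>homology D\<^esub>}"

text \<open>The differential module \<open>(C \<oplus> C, \<delta>)\<close> with \<open>\<delta> (c', c'') = (c'', 0)\<close>.\<close>

definition contractible_model :: "('a, 'b, 'm) module_scheme \<Rightarrow> ('a, 'b \<times> 'b) diff_module"
  where "contractible_model C = with_diff (module_sum C C) (\<lambda>(c', c''). (c'', \<zero>\<^bsub>C\<^esub>))"

text \<open>Again \<open>C\<close> embeds into \<open>D\<close>, hence can be carried by the type of \<open>D\<close>; see lemma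
  \<open>contractibleI\<close> below.\<close>

definition contractible_module ::
    "('a, 'r) ring_scheme \<Rightarrow> ('a, 'b, 'd) diff_module_scheme \<Rightarrow> bool"
  where "contractible_module R D \<longleftrightarrow>
    (\<exists>C :: ('a, 'b) module. left_module R C \<and> diff_isomorphic R D (contractible_model C))"

definition differential_flag ::
    "('a, 'r) ring_scheme \<Rightarrow> ('a, 'b, 'd) diff_module_scheme \<Rightarrow> (int \<Rightarrow> 'b set) \<Rightarrow> bool"
  where "differential_flag R F Fl \<longleftrightarrow>
    (\<forall>n. submodule (Fl n) R F) \<and>
    (\<forall>n. Fl n \<subseteq> Fl (n + 1)) \<and>
    Fl (- 1) = {\<zero>\<^bsub>F\<^esub>} \<and>
    (\<Union>n. Fl n) = carrier F \<and>
    (\<forall>n. diff F ` Fl n \<subseteq> Fl (n - 1))"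

definition projective_flag ::
    "('a, 'r) ring_scheme \<Rightarrow> ('a, 'b, 'd) diff_module_scheme \<Rightarrow> (int \<Rightarrow> 'b set) \<Rightarrow> bool"
  where "projective_flag R F Fl \<longleftrightarrow>
    differential_flag R F Fl \<and>
    (\<forall>n. projective_module R (quotient_module (F\<lparr>carrier := Fl n\<rparr>) (Fl (n - 1))))"


section \<open>Independence of the carrier types\<close>

lemma left_moduleI:
  fixes R (structure) and M (structure)
  assumes "ring R"
    and "\<And>x y. \<lbrakk>x \<in> carrier M; y \<in> carrier M\<rbrakk> \<Longrightarrow> x \<oplus>\<^bsub>M\<^esub> y \<in> carrier M"
    and "\<zero>\<^bsub>M\<^esub> \<in> carrier M"
    and "\<And>x y z. \<lbrakk>x \<in> carrier M; y \<in> carrier M; z \<in> carrier M\<rbrakk> \<Longrightarrow>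
          (x \<oplus>\<^bsub>M\<^esub> y) \<oplus>\<^bsub>M\<^esub> z = x \<oplus>\<^bsub>M\<^esub> (y \<oplus>\<^bsub>M\<^esub> z)"
    and "\<And>x y. \<lbrakk>x \<in> carrier M; y \<in> carrier M\<rbrakk> \<Longrightarrow> x \<oplus>\<^bsub>M\<^esub> y = y \<oplus>\<^bsub>M\<^esub> x"
    and "\<And>x. x \<in> carrier M \<Longrightarrow> \<zero>\<^bsub>M\<^esub> \<oplus>\<^bsub>M\<^esub> x = x"
    and "\<And>x. x \<in> carrier M \<Longrightarrow> \<exists>y\<in>carrier M. y \<oplus>\<^bsub>M\<^esub> x = \<zero>\<^bsub>M\<^esub>"
    and "\<And>a x. \<lbrakk>a \<in> carrier R; x \<in> carrier M\<rbrakk> \<Longrightarrow> a \<odot>\<^bsub>M\<^esub> x \<in> carrier M"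
    and "\<And>a b x. \<lbrakk>a \<in> carrier R; b \<in> carrier R; x \<in> carrier M\<rbrakk> \<Longrightarrow>
          (a \<oplus> b) \<odot>\<^bsub>M\<^esub> x = a \<odot>\<^bsub>M\<^esub> x \<oplus>\<^bsub>M\<^esub> b \<odot>\<^bsub>M\<^esub> x"
    and "\<And>a x y. \<lbrakk>a \<in> carrier R; x \<in> carrier M; y \<in> carrier M\<rbrakk> \<Longrightarrow>
          a \<odot>\<^bsub>M\<^esub> (x \<oplus>\<^bsub>M\<^esub> y) = a \<odot>\<^bsub>M\<^esub> x \<oplus>\<^bsub>M\<^esub> a \<odot>\<^bsub>M\<^esub> y"
    and "\<And>a b x. \<lbrakk>a \<in> carrier R; b \<in> carrier R; x \<in> carrier M\<rbrakk> \<Longrightarrow>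
          (a \<otimes> b) \<odot>\<^bsub>M\<^esub> x = a \<odot>\<^bsub>M\<^esub> (b \<odot>\<^bsub>M\<^esub> x)"
    and "\<And>x. x \<in> carrier M \<Longrightarrow> \<one> \<odot>\<^bsub>M\<^esub> x = x"
  shows "left_module R M"
  using assms
  by (intro left_module.intro abelian_groupI left_module_axioms.intro) auto

lemma (in left_module) smult_r_null [simp]:
  assumes "a \<in> carrier R" shows "a \<odot>\<^bsub>M\<^esub> \<zero>\<^bsub>M\<^esub> = \<zero>\<^bsub>M\<^esub>"
proof -
  have "a \<odot>\<^bsub>M\<^esub> \<zero>\<^bsub>M\<^esub> \<oplus>\<^bsub>M\<^esub> a \<odot>\<^bsub>M\<^esub> \<zero>\<^bsub>M\<^esub> = a \<odot>\<^bsub>M\<^esub> \<zero>\<^bsub>M\<^esub>"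
    using assms smult_r_distr[of a "\<zero>\<^bsub>M\<^esub>" "\<zero>\<^bsub>M\<^esub>"] by simp
  then show ?thesis using assms M.add.r_cancel_one' by (metis M.zero_closed smult_closed)
qed

lemma (in left_module) smult_l_null [simp]:
  assumes "x \<in> carrier M" shows "\<zero> \<odot>\<^bsub>M\<^esub> x = \<zero>\<^bsub>M\<^esub>"
proof -
  have "\<zero> \<odot>\<^bsub>M\<^esub> x \<oplus>\<^bsub>M\<^esub> \<zero> \<odot>\<^bsub>M\<^esub> x = \<zero> \<odot>\<^bsub>M\<^esub> x"
    using assms smult_l_distr[of "\<zero>" "\<zero>" x] by simp
  then show ?thesis using assms M.add.r_cancel_one' by (metis R.zero_closed smult_closed)
qed

lemma (in left_module) finsum_smult:
  assumes "finite A" "a \<in> carrier R" "f \<in> A \<rightarrow> carrier M"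
  shows "a \<odot>\<^bsub>M\<^esub> (\<Oplus>\<^bsub>M\<^esub>i\<in>A. f i) = (\<Oplus>\<^bsub>M\<^esub>i\<in>A. a \<odot>\<^bsub>M\<^esub> f i)"
  using assms by (induct set: finite) (simp_all add: Pi_def smult_r_distr)

lemma module_hom_zero:
  assumes "left_module R M" "left_module R N" "h \<in> module_hom R M N"
  shows "h \<zero>\<^bsub>M\<^esub> = \<zero>\<^bsub>N\<^esub>"
proof -
  interpret M: left_module R M by fact
  interpret N: left_module R N by fact
  have c: "h \<zero>\<^bsub>M\<^esub> \<in> carrier N" using assms(3) by (auto simp: module_hom_def)
  have "h (\<zero>\<^bsub>M\<^esub> \<oplus>\<^bsub>M\<^esub> \<zero>\<^bsub>M\<^esub>) = h \<zero>\<^bsub>M\<^esub> \<oplus>\<^bsub>N\<^esub> h \<zero>\<^bsub>M\<^esub>"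
    using assms(3) M.M.zero_closed unfolding module_hom_def by blast
  then have "h \<zero>\<^bsub>M\<^esub> \<oplus>\<^bsub>N\<^esub> h \<zero>\<^bsub>M\<^esub> = h \<zero>\<^bsub>M\<^esub>" by simp
  then show ?thesis using c N.M.add.r_cancel_one' by metis
qed

lemma module_hom_finsum:
  assumes "left_module R M" "left_module R N" "h \<in> module_hom R M N"
    and "finite A" "f \<in> A \<rightarrow> carrier M"
  shows "h (\<Oplus>\<^bsub>M\<^esub>i\<in>A. f i) = (\<Oplus>\<^bsub>N\<^esub>i\<in>A. h (f i))"
proof -
  interpret M: left_module R M by fact
  interpret N: left_module R N by fact
  have hc: "h x \<in> carrier N" if "x \<in> carrier M" for x
    using assms(3) that by (auto simp: module_hom_def)
  show ?thesis using assms(4,5)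
  proof (induct set: finite)
    case empty
    show ?case using module_hom_zero[OF assms(1-3)] by simp
  next
    case (insert x A)
    have "f x \<in> carrier M" "(\<Oplus>\<^bsub>M\<^esub>i\<in>A. f i) \<in> carrier M"
      using insert by (auto intro: M.M.finsum_closed)
    then have "h (f x \<oplus>\<^bsub>M\<^esub> (\<Oplus>\<^bsub>M\<^esub>i\<in>A. f i)) = h (f x) \<oplus>\<^bsub>N\<^esub> h (\<Oplus>\<^bsub>M\<^esub>i\<in>A. f i)"
      using assms(3) by (auto simp: module_hom_def)
    then show ?case using insert hc by (simp add: Pi_def)
  qed
qed

lemma left_module_quotient:
  assumes "left_module R M" and "submodule N R M"
  shows "left_module R (quotient_module M N)"
proof -
  interpret M: left_module R M by fact
  interpret N: submodule N R M by fact
  interpret AN: abelian_subgroup N M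
    by (intro abelian_subgroupI3)
      (simp_all add: additive_subgroup_def N.subgroup_axioms M.M.abelian_group_axioms)
  have Nc: "n \<in> carrier M" if "n \<in> N" for n using that N.subset by auto
  have N0: "\<zero>\<^bsub>M\<^esub> \<in> N" using N.one_closed by simp
  have Na: "n \<oplus>\<^bsub>M\<^esub> m \<in> N" if "n \<in> N" "m \<in> N" for n m
    using N.m_closed that by simp
  have sm: "N <+>\<^bsub>M\<^esub> ((\<lambda>x. a \<odot>\<^bsub>M\<^esub> x) ` (N +>\<^bsub>M\<^esub> x)) = N +>\<^bsub>M\<^esub> (a \<odot>\<^bsub>M\<^esub> x)"
    if a: "a \<in> carrier R" and x: "x \<in> carrier M" for a x
  proof (intro equalityI subsetI)
    fix z assume "z \<in> N <+>\<^bsub>M\<^esub> ((\<lambda>x. a \<odot>\<^bsub>M\<^esub> x) ` (N +>\<^bsub>M\<^esub> x))"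
    then obtain n m where nm: "n \<in> N" "m \<in> N" and z: "z = n \<oplus>\<^bsub>M\<^esub> a \<odot>\<^bsub>M\<^esub> (m \<oplus>\<^bsub>M\<^esub> x)"
      unfolding set_add_def' a_r_coset_def' by auto
    have "z = (n \<oplus>\<^bsub>M\<^esub> a \<odot>\<^bsub>M\<^esub> m) \<oplus>\<^bsub>M\<^esub> a \<odot>\<^bsub>M\<^esub> x"
      using nm Nc a x z by (simp add: M.smult_r_distr M.M.a_assoc)
    moreover have "n \<oplus>\<^bsub>M\<^esub> a \<odot>\<^bsub>M\<^esub> m \<in> N" using nm a Na by simp
    ultimately show "z \<in> N +>\<^bsub>M\<^esub> (a \<odot>\<^bsub>M\<^esub> x)" unfolding a_r_coset_def' by auto
  next
    fix z assume "z \<in> N +>\<^bsub>M\<^esub> (a \<odot>\<^bsub>M\<^esub> x)"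
    then obtain n where n: "n \<in> N" "z = n \<oplus>\<^bsub>M\<^esub> a \<odot>\<^bsub>M\<^esub> x"
      unfolding a_r_coset_def' by auto
    have "x \<in> N +>\<^bsub>M\<^esub> x" using AN.a_rcos_self[OF x] .
    then show "z \<in> N <+>\<^bsub>M\<^esub> ((\<lambda>x. a \<odot>\<^bsub>M\<^esub> x) ` (N +>\<^bsub>M\<^esub> x))"
      using n unfolding set_add_def' by auto
  qed
  have car: "X \<in> a_rcosets\<^bsub>M\<^esub> N \<longleftrightarrow> (\<exists>x\<in>carrier M. X = N +>\<^bsub>M\<^esub> x)" for X
    unfolding A_RCOSETS_def' by auto
  have N: "N = N +>\<^bsub>M\<^esub> \<zero>\<^bsub>M\<^esub>" using M.M.a_coset_add_zero[of N] N.subset by auto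
  note ac = AN.a_rcos_sum
  let ?Q = "quotient_module M N"
  have cQ: "X \<in> carrier ?Q \<longleftrightarrow> (\<exists>x\<in>carrier M. X = N +>\<^bsub>M\<^esub> x)" for X
    by (simp add: quotient_module_def car)
  have aQ: "(N +>\<^bsub>M\<^esub> x) \<oplus>\<^bsub>?Q\<^esub> (N +>\<^bsub>M\<^esub> y) = N +>\<^bsub>M\<^esub> (x \<oplus>\<^bsub>M\<^esub> y)"
    if "x \<in> carrier M" "y \<in> carrier M" for x y
    using ac that by (simp add: quotient_module_def)
  have zQ: "\<zero>\<^bsub>?Q\<^esub> = N +>\<^bsub>M\<^esub> \<zero>\<^bsub>M\<^esub>" using N by (simp add: quotient_module_def)
  have sQ: "a \<odot>\<^bsub>?Q\<^esub> (N +>\<^bsub>M\<^esub> x) = N +>\<^bsub>M\<^esub> (a \<odot>\<^bsub>M\<^esub> x)" if "a \<in> carrier R" "x \<in> carrier M" for a x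
    using sm that by (simp add: quotient_module_def)
  have inv: "\<exists>Y\<in>carrier ?Q. Y \<oplus>\<^bsub>?Q\<^esub> X = \<zero>\<^bsub>?Q\<^esub>" if "X \<in> carrier ?Q" for X
  proof -
    obtain x where x: "x \<in> carrier M" "X = N +>\<^bsub>M\<^esub> x" using \<open>X \<in> _\<close> cQ by auto
    have "(N +>\<^bsub>M\<^esub> (\<ominus>\<^bsub>M\<^esub> x)) \<oplus>\<^bsub>?Q\<^esub> X = \<zero>\<^bsub>?Q\<^esub>"
      unfolding x(2) zQ by (subst aQ) (use x in \<open>simp_all add: M.M.l_neg\<close>)
    then show ?thesis using x(1) cQ M.M.a_inv_closed by blast
  qed
  show ?thesis
  proof (rule left_moduleI)
    show "ring R" by (rule M.R.ring_axioms)
    show "\<And>X. X \<in> carrier ?Q \<Longrightarrow> \<exists>Y\<in>carrier ?Q. Y \<oplus>\<^bsub>?Q\<^esub> X = \<zero>\<^bsub>?Q\<^esub>" by (rule inv)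
    show "\<zero>\<^bsub>?Q\<^esub> \<in> carrier ?Q" unfolding cQ zQ using M.M.zero_closed by blast
    show "\<And>X Y. \<lbrakk>X \<in> carrier ?Q; Y \<in> carrier ?Q\<rbrakk> \<Longrightarrow> X \<oplus>\<^bsub>?Q\<^esub> Y \<in> carrier ?Q"
      unfolding cQ by (metis aQ M.M.a_closed)
    show "\<And>a X. \<lbrakk>a \<in> carrier R; X \<in> carrier ?Q\<rbrakk> \<Longrightarrow> a \<odot>\<^bsub>?Q\<^esub> X \<in> carrier ?Q"
      unfolding cQ by (metis sQ M.smult_closed)
  qed (auto simp: cQ aQ zQ sQ M.M.a_ac M.smult_l_distr M.smult_r_distr M.smult_assoc1)
qed

text \<open>Transport of structure along an injection.\<close>

definition transport :: "('b \<Rightarrow> 'c) \<Rightarrow> ('a, 'b, 'm) module_scheme \<Rightarrow> ('a, 'c) module"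
  where "transport j M =
    \<lparr>carrier = j ` carrier M, mult = undefined, one = undefined, zero = j \<zero>\<^bsub>M\<^esub>,
     add = (\<lambda>x y. j (inv_into (carrier M) j x \<oplus>\<^bsub>M\<^esub> inv_into (carrier M) j y)),
     smult = (\<lambda>a x. j (a \<odot>\<^bsub>M\<^esub> inv_into (carrier M) j x))\<rparr>"

lemma left_module_transport:
  assumes "left_module R M" and "inj_on j (carrier M)"
  shows "left_module R (transport j M)"
proof -
  interpret M: left_module R M by fact
  have [simp]: "inv_into (carrier M) j (j x) = x" if "x \<in> carrier M" for x
    using that assms(2) by simp
  show ?thesis
  proof (rule left_moduleI)
    show "ring R" by (rule M.R.ring_axioms)
    show "\<exists>y\<in>carrier (transport j M). y \<oplus>\<^bsub>transport j M\<^esub> x = \<zero>\<^bsub>transport j M\<^esub>"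
      if x: "x \<in> carrier (transport j M)" for x
    proof -
      obtain u where "u \<in> carrier M" "x = j u" using x by (auto simp: transport_def)
      then show ?thesis
        by (intro bexI[of _ "j (\<ominus>\<^bsub>M\<^esub> u)"]) (simp_all add: transport_def M.M.l_neg)
    qed
  qed (auto simp: transport_def M.M.a_ac M.smult_l_distr M.smult_r_distr
      M.smult_assoc1)
qed

lemma contractibleI:
  fixes D :: "('a, 'b, 'd) diff_module_scheme" and C :: "('a, 'c, 'm) module_scheme"
  assumes D: "differential_module R D" and C: "left_module R C"
    and iso: "diff_isomorphic R D (contractible_model C)"
  shows "contractible_module R D"
proof -
  interpret D: differential_module R D by fact
  interpret C: left_module R C by fact
  obtain h where h: "h \<in> diff_module_hom R D (contractible_model C)"
    and bij: "bij_betw h (carrier D) (carrier C \<times> carrier C)"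
    using iso by (auto simp: diff_isomorphic_def contractible_model_def with_diff_def module_sum_def)
  define j where "j c = inv_into (carrier D) h (c, \<zero>\<^bsub>C\<^esub>)" for c
  have inj: "inj_on j (carrier C)"
  proof (rule inj_onI)
    fix c c' assume "c \<in> carrier C" "c' \<in> carrier C" "j c = j c'"
    then have "(c, \<zero>\<^bsub>C\<^esub>) = (c', \<zero>\<^bsub>C\<^esub>)"
      unfolding j_def using bij_betw_inv_into_right[OF bij]
      by (metis C.M.zero_closed mem_Sigma_iff)
    then show "c = c'" by simp
  qed
  let ?T = "transport j C"
  have [simp]: "inv_into (carrier C) j (j x) = x" if "x \<in> carrier C" for x
    using that inj by simp
  have T: "left_module R ?T" by (rule left_module_transport[OF C inj])
  define k where "k x = (case h x of (c, c') \<Rightarrow> (j c, j c'))" for x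
  have hc: "fst (h x) \<in> carrier C" "snd (h x) \<in> carrier C" if "x \<in> carrier D" for x
    using bij_betwE[OF bij] that by (auto simp: mem_Times_iff)
  have "k \<in> diff_module_hom R D (contractible_model ?T)"
    using h hc
    by (auto simp: diff_module_hom_def module_hom_def k_def contractible_model_def with_diff_def
        module_sum_def transport_def case_prod_beta)
  moreover have "bij_betw k (carrier D) (carrier (contractible_model ?T))"
  proof -
    have "bij_betw (map_prod j j) (carrier C \<times> carrier C) (j ` carrier C \<times> j ` carrier C)"
      using inj by (intro bij_betw_map_prod) (simp_all add: bij_betw_def)
    from bij_betw_trans[OF bij this] have "bij_betw (map_prod j j \<circ> h) (carrier D) (j ` carrier C \<times> j ` carrier C)" .
    moreover have "map_prod j j \<circ> h = k" by (auto simp: k_def fun_eq_iff split: prod.split)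
    ultimately show ?thesis
      by (simp add: contractible_model_def with_diff_def module_sum_def transport_def)
  qed
  ultimately show ?thesis
    unfolding contractible_module_def diff_isomorphic_def using T by blast
qed

lemma retractI:
  fixes D :: "('a, 'b, 'd) diff_module_scheme" and F :: "('a, 'c, 'f) diff_module_scheme"
    and E :: "('a, 'e, 'm) diff_module_scheme"
  assumes D: "differential_module R D" and E: "differential_module R E"
    and iso: "diff_isomorphic R F (diff_module_sum D E)"
  shows "retract_of R D F"
proof -
  interpret D: differential_module R D by fact
  interpret E: differential_module R E by fact
  obtain h where h: "h \<in> diff_module_hom R F (diff_module_sum D E)"
    and bij: "bij_betw h (carrier F) (carrier D \<times> carrier E)"
    using iso by (auto simp: diff_isomorphic_def diff_module_sum_def with_diff_def module_sum_def)
  define j where "j e = inv_into (carrier F) h (\<zero>\<^bsub>D\<^esub>, e)" for e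
  have inj: "inj_on j (carrier E)"
  proof (rule inj_onI)
    fix c c' assume "c \<in> carrier E" "c' \<in> carrier E" "j c = j c'"
    then have "(\<zero>\<^bsub>D\<^esub>, c) = (\<zero>\<^bsub>D\<^esub>, c')"
      unfolding j_def using bij_betw_inv_into_right[OF bij]
      by (metis D.M.zero_closed mem_Sigma_iff)
    then show "c = c'" by simp
  qed
  have [simp]: "inv_into (carrier E) j (j x) = x" if "x \<in> carrier E" for x
    using that inj by simp
  define T where "T = with_diff (transport j E) (\<lambda>x. j (diff E (inv_into (carrier E) j x)))"
  have dE: "diff E x \<in> carrier E" if "x \<in> carrier E" for x
    using E.diff_hom that by (auto simp: module_hom_def)
  have T0: "left_module R (transport j E)"
    by (rule left_module_transport[OF E.left_module_axioms inj])
  have "left_module R T"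
  proof -
    interpret T0: left_module R "transport j E" by (rule T0)
    have eq: "carrier T = carrier (transport j E)" "\<zero>\<^bsub>T\<^esub> = \<zero>\<^bsub>transport j E\<^esub>"
      "add T = add (transport j E)" "smult T = smult (transport j E)"
      by (simp_all add: T_def with_diff_def)
    show ?thesis
    proof (rule left_moduleI)
      show "ring R" using E.left_module_axioms by (simp add: left_module_def)
      show "\<exists>y\<in>carrier T. y \<oplus>\<^bsub>T\<^esub> x = \<zero>\<^bsub>T\<^esub>" if "x \<in> carrier T" for x
        using that unfolding eq by (intro bexI[of _ "\<ominus>\<^bsub>transport j E\<^esub> x"]) (simp_all add: T0.M.l_neg)
    qed (auto simp: eq T0.M.a_ac T0.smult_l_distr T0.smult_r_distr T0.smult_assoc1)
  qed
  moreover have "diff T \<in> module_hom R T T"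
    using E.diff_hom dE unfolding module_hom_def
    by (auto simp: T_def with_diff_def transport_def)
  moreover have "diff T (diff T x) = \<zero>\<^bsub>T\<^esub>" if "x \<in> carrier T" for x
    using that dE E.diff_diff by (auto simp: T_def with_diff_def transport_def)
  ultimately have T: "differential_module R T"
    by (simp add: differential_module_def differential_module_axioms_def)
  define k where "k x = (case h x of (c, e) \<Rightarrow> (c, j e))" for x
  have hc: "fst (h x) \<in> carrier D" "snd (h x) \<in> carrier E" if "x \<in> carrier F" for x
    using bij_betwE[OF bij] that by (auto simp: mem_Times_iff)
  have "k \<in> diff_module_hom R F (diff_module_sum D T)"
    using h hc
    by (auto simp: diff_module_hom_def module_hom_def k_def diff_module_sum_def T_def with_diff_def
        module_sum_def transport_def case_prod_beta)
  moreover have "bij_betw k (carrier F) (carrier (diff_module_sum D T))"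
  proof -
    have "bij_betw (map_prod id j) (carrier D \<times> carrier E) (carrier D \<times> j ` carrier E)"
      using inj by (intro bij_betw_map_prod) (simp_all add: bij_betw_def)
    from bij_betw_trans[OF bij this]
    have "bij_betw (map_prod id j \<circ> h) (carrier F) (carrier D \<times> j ` carrier E)" .
    moreover have "map_prod id j \<circ> h = k" by (auto simp: k_def fun_eq_iff split: prod.split)
    ultimately show ?thesis
      by (simp add: diff_module_sum_def T_def with_diff_def module_sum_def transport_def)
  qed
  ultimately show ?thesis
    unfolding retract_of_def diff_isomorphic_def using T by blast
qed

text \<open>The free module on a set \<open>X\<close>: finitely supported functions.\<close>

definition free_module :: "('a, 'r) ring_scheme \<Rightarrow> 'b set \<Rightarrow> ('a, 'b \<Rightarrow> 'a) module"
  where "free_module R X =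
    \<lparr>carrier = {\<phi>. range \<phi> \<subseteq> carrier R \<and> finite {x. \<phi> x \<noteq> \<zero>\<^bsub>R\<^esub>} \<and> {x. \<phi> x \<noteq> \<zero>\<^bsub>R\<^esub>} \<subseteq> X},
     mult = undefined, one = undefined, zero = (\<lambda>x. \<zero>\<^bsub>R\<^esub>),
     add = (\<lambda>\<phi> \<psi> x. \<phi> x \<oplus>\<^bsub>R\<^esub> \<psi> x), smult = (\<lambda>a \<phi> x. a \<otimes>\<^bsub>R\<^esub> \<phi> x)\<rparr>"

lemma left_module_free:
  assumes "ring R"
  shows "left_module R (free_module R X)"
proof -
  interpret R: ring R by fact
  have fa: "finite {x. \<phi> x \<oplus>\<^bsub>R\<^esub> \<psi> x \<noteq> \<zero>\<^bsub>R\<^esub>}"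
    if "finite {x. \<phi> x \<noteq> \<zero>\<^bsub>R\<^esub>}" "finite {x. \<psi> x \<noteq> \<zero>\<^bsub>R\<^esub>}" for \<phi> \<psi>
    by (rule finite_subset[OF _ finite_UnI[OF that]]) auto
  have fs: "finite {x. a \<otimes>\<^bsub>R\<^esub> \<phi> x \<noteq> \<zero>\<^bsub>R\<^esub>}"
    if "finite {x. \<phi> x \<noteq> \<zero>\<^bsub>R\<^esub>}" "a \<in> carrier R" for a \<phi>
    by (rule finite_subset[OF _ that(1)]) (use that in auto)
  have cl: "\<phi> x \<in> carrier R" if "range \<phi> \<subseteq> carrier R" for \<phi> x using that by auto
  show ?thesis
  proof (rule left_moduleI)
    show "ring R" by fact
    show "\<exists>\<psi>\<in>carrier (free_module R X). \<psi> \<oplus>\<^bsub>free_module R X\<^esub> \<phi> = \<zero>\<^bsub>free_module R X\<^esub>"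
      if \<phi>: "\<phi> \<in> carrier (free_module R X)" for \<phi>
    proof (rule bexI)
      have c: "\<phi> x \<in> carrier R" for x using \<phi> by (auto simp: free_module_def)
      then show "(\<lambda>x. \<ominus>\<^bsub>R\<^esub> \<phi> x) \<oplus>\<^bsub>free_module R X\<^esub> \<phi> = \<zero>\<^bsub>free_module R X\<^esub>"
        by (simp add: free_module_def R.l_neg)
      have "{x. \<ominus>\<^bsub>R\<^esub> \<phi> x \<noteq> \<zero>\<^bsub>R\<^esub>} \<subseteq> {x. \<phi> x \<noteq> \<zero>\<^bsub>R\<^esub>}" by auto
      then show "(\<lambda>x. \<ominus>\<^bsub>R\<^esub> \<phi> x) \<in> carrier (free_module R X)"
        using \<phi> c by (auto simp: free_module_def intro: finite_subset)
    qed
  next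
    fix \<phi> \<psi> assume "\<phi> \<in> carrier (free_module R X)" "\<psi> \<in> carrier (free_module R X)"
    then have c: "\<phi> x \<in> carrier R" "\<psi> x \<in> carrier R"
      and f: "finite {x. \<phi> x \<noteq> \<zero>\<^bsub>R\<^esub>}" "finite {x. \<psi> x \<noteq> \<zero>\<^bsub>R\<^esub>}"
      and X: "\<phi> x \<noteq> \<zero>\<^bsub>R\<^esub> \<Longrightarrow> x \<in> X" "\<psi> x \<noteq> \<zero>\<^bsub>R\<^esub> \<Longrightarrow> x \<in> X" for x
      by (auto simp: free_module_def)
    have "x \<in> X" if "\<phi> x \<oplus>\<^bsub>R\<^esub> \<psi> x \<noteq> \<zero>\<^bsub>R\<^esub>" for x
      using that X(1)[of x] X(2)[of x] R.r_zero[OF R.zero_closed] by metis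
    then show "\<phi> \<oplus>\<^bsub>free_module R X\<^esub> \<psi> \<in> carrier (free_module R X)"
      using c fa[OF f] by (auto simp: free_module_def)
  next
    fix a \<phi> assume a: "a \<in> carrier R" and "\<phi> \<in> carrier (free_module R X)"
    then have c: "\<phi> x \<in> carrier R" and f: "finite {x. \<phi> x \<noteq> \<zero>\<^bsub>R\<^esub>}"
      and X: "\<phi> x \<noteq> \<zero>\<^bsub>R\<^esub> \<Longrightarrow> x \<in> X" for x
      by (auto simp: free_module_def)
    have "x \<in> X" if "a \<otimes>\<^bsub>R\<^esub> \<phi> x \<noteq> \<zero>\<^bsub>R\<^esub>" for x
      using that a X[of x] R.r_null[OF a] by metis
    then show "a \<odot>\<^bsub>free_module R X\<^esub> \<phi> \<in> carrier (free_module R X)"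
      using c a fs[OF f a] by (auto simp: free_module_def)
  qed (auto simp: free_module_def fun_eq_iff R.a_assoc R.m_assoc R.l_distr R.r_distr cl
      intro: R.a_comm)
qed

definition free_lift ::
    "('a, 'r) ring_scheme \<Rightarrow> ('a, 'c, 'm) module_scheme \<Rightarrow> ('b \<Rightarrow> 'c) \<Rightarrow> ('b \<Rightarrow> 'a) \<Rightarrow> 'c"
  where "free_lift R M u \<phi> = (\<Oplus>\<^bsub>M\<^esub>x\<in>{x. \<phi> x \<noteq> \<zero>\<^bsub>R\<^esub>}. \<phi> x \<odot>\<^bsub>M\<^esub> u x)"

lemma free_lift_superset:
  assumes "left_module R M" "\<phi> \<in> carrier (free_module R X)" "u \<in> X \<rightarrow> carrier M"
    and "finite S" "{x. \<phi> x \<noteq> \<zero>\<^bsub>R\<^esub>} \<subseteq> S" "S \<subseteq> X"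
  shows "free_lift R M u \<phi> = (\<Oplus>\<^bsub>M\<^esub>x\<in>S. \<phi> x \<odot>\<^bsub>M\<^esub> u x)"
proof -
  interpret M: left_module R M by fact
  have c: "\<phi> x \<in> carrier R" for x using assms(2) by (auto simp: free_module_def)
  have uS: "u x \<in> carrier M" if "x \<in> S" for x using assms(3,6) that by blast
  show ?thesis unfolding free_lift_def
    using assms(4,5) c uS by (intro M.M.add.finprod_mono_neutral_cong_left) auto
qed

lemma free_lift_hom:
  assumes M: "left_module R M" and u: "u \<in> X \<rightarrow> carrier M"
  shows "free_lift R M u \<in> module_hom R (free_module R X) M"
proof -
  interpret M: left_module R M by fact
  let ?L = "free_module R X"
  interpret L: left_module R ?L by (rule left_module_free[OF M.R.ring_axioms])
  let ?s = "\<lambda>\<phi>. {x. \<phi> x \<noteq> \<zero>\<^bsub>R\<^esub>}"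
  have c: "\<phi> x \<in> carrier R" if "\<phi> \<in> carrier ?L" for \<phi> x
    using that by (auto simp: free_module_def)
  have f: "finite (?s \<phi>)" "?s \<phi> \<subseteq> X" if "\<phi> \<in> carrier ?L" for \<phi>
    using that by (auto simp: free_module_def)
  have "free_lift R M u \<phi> \<in> carrier M" if "\<phi> \<in> carrier ?L" for \<phi>
    unfolding free_lift_def using f[OF that] c[OF that] u by (intro M.M.finsum_closed) auto
  moreover have "free_lift R M u (\<phi> \<oplus>\<^bsub>?L\<^esub> \<psi>) = free_lift R M u \<phi> \<oplus>\<^bsub>M\<^esub> free_lift R M u \<psi>"
    if \<phi>: "\<phi> \<in> carrier ?L" and \<psi>: "\<psi> \<in> carrier ?L" for \<phi> \<psi>
  proof -
    let ?S = "?s \<phi> \<union> ?s \<psi>"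
    have S: "finite ?S" "?S \<subseteq> X" using f[OF \<phi>] f[OF \<psi>] by auto
    have uS: "u x \<in> carrier M" if "x \<in> ?S" for x using that S u by blast
    have "?s (\<phi> \<oplus>\<^bsub>?L\<^esub> \<psi>) \<subseteq> ?S" by (auto simp: free_module_def)
    then have "free_lift R M u (\<phi> \<oplus>\<^bsub>?L\<^esub> \<psi>) = (\<Oplus>\<^bsub>M\<^esub>x\<in>?S. (\<phi> \<oplus>\<^bsub>?L\<^esub> \<psi>) x \<odot>\<^bsub>M\<^esub> u x)"
      using \<phi> \<psi> S u by (intro free_lift_superset[OF M]) auto
    also have "\<dots> = (\<Oplus>\<^bsub>M\<^esub>x\<in>?S. \<phi> x \<odot>\<^bsub>M\<^esub> u x \<oplus>\<^bsub>M\<^esub> \<psi> x \<odot>\<^bsub>M\<^esub> u x)"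
      using uS c[OF \<phi>] c[OF \<psi>]
      by (intro M.M.finsum_cong') (auto simp: free_module_def M.smult_l_distr)
    also have "\<dots> = (\<Oplus>\<^bsub>M\<^esub>x\<in>?S. \<phi> x \<odot>\<^bsub>M\<^esub> u x) \<oplus>\<^bsub>M\<^esub> (\<Oplus>\<^bsub>M\<^esub>x\<in>?S. \<psi> x \<odot>\<^bsub>M\<^esub> u x)"
      using uS c[OF \<phi>] c[OF \<psi>] by (intro M.M.finsum_addf) auto
    also have "(\<Oplus>\<^bsub>M\<^esub>x\<in>?S. \<phi> x \<odot>\<^bsub>M\<^esub> u x) = free_lift R M u \<phi>"
      using \<phi> S u by (intro free_lift_superset[OF M, symmetric]) auto
    also have "(\<Oplus>\<^bsub>M\<^esub>x\<in>?S. \<psi> x \<odot>\<^bsub>M\<^esub> u x) = free_lift R M u \<psi>"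
      using \<psi> S u by (intro free_lift_superset[OF M, symmetric]) auto
    finally show ?thesis .
  qed
  moreover have "free_lift R M u (a \<odot>\<^bsub>?L\<^esub> \<phi>) = a \<odot>\<^bsub>M\<^esub> free_lift R M u \<phi>"
    if a: "a \<in> carrier R" and \<phi>: "\<phi> \<in> carrier ?L" for a \<phi>
  proof -
    let ?S = "?s \<phi>"
    have uS: "u x \<in> carrier M" if "x \<in> ?S" for x using that f[OF \<phi>] u by blast
    have "?s (a \<odot>\<^bsub>?L\<^esub> \<phi>) \<subseteq> ?S" using a by (auto simp: free_module_def)
    then have "free_lift R M u (a \<odot>\<^bsub>?L\<^esub> \<phi>) = (\<Oplus>\<^bsub>M\<^esub>x\<in>?S. (a \<odot>\<^bsub>?L\<^esub> \<phi>) x \<odot>\<^bsub>M\<^esub> u x)"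
      using a \<phi> f[OF \<phi>] u by (intro free_lift_superset[OF M]) auto
    also have "\<dots> = (\<Oplus>\<^bsub>M\<^esub>x\<in>?S. a \<odot>\<^bsub>M\<^esub> (\<phi> x \<odot>\<^bsub>M\<^esub> u x))"
      using uS c[OF \<phi>] a
      by (intro M.M.finsum_cong') (auto simp: free_module_def M.smult_assoc1)
    also have "\<dots> = a \<odot>\<^bsub>M\<^esub> free_lift R M u \<phi>"
      unfolding free_lift_def using f[OF \<phi>] a uS c[OF \<phi>]
      by (intro M.finsum_smult[symmetric]) auto
    finally show ?thesis .
  qed
  ultimately show ?thesis by (simp add: module_hom_def)
qed

lemma module_of_scheme:
  assumes "left_module R P"
  shows "left_module R (module.truncate P)"
proof -
  interpret P: left_module R P by fact
  show ?thesis
  proof (rule left_moduleI)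
    show "ring R" by (rule P.R.ring_axioms)
    show "\<exists>y\<in>carrier (module.truncate P). y \<oplus>\<^bsub>module.truncate P\<^esub> x = \<zero>\<^bsub>module.truncate P\<^esub>"
      if "x \<in> carrier (module.truncate P)" for x
      using that by (intro bexI[of _ "\<ominus>\<^bsub>P\<^esub> x"]) (simp_all add: module.defs P.M.l_neg)
  qed (auto simp: module.defs P.M.a_ac P.smult_l_distr P.smult_r_distr P.smult_assoc1)
qed

text \<open>Here \<open>M\<close> and \<open>N\<close> are carried by arbitrary types.\<close>

lemma projective_lift:
  fixes P :: "('a, 'b, 'm) module_scheme" and M :: "('a, 'c, 'n) module_scheme"
    and N :: "('a, 'd, 'o) module_scheme"
  assumes proj: "projective_module R P" and M: "left_module R M" and N: "left_module R N"
    and g: "g \<in> module_hom R M N" and surj: "g ` carrier M = carrier N"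
    and f: "f \<in> module_hom R P N"
  shows "\<exists>h \<in> module_hom R P M. \<forall>x\<in>carrier P. g (h x) = f x"
proof -
  have P: "left_module R P" using proj by (simp add: projective_module_def)
  interpret P: left_module R P by (rule P)
  interpret M: left_module R M by fact
  interpret N: left_module R N by fact
  let ?L = "free_module R (carrier P)"
  let ?P = "module.truncate P"
  interpret L: left_module R ?L by (rule left_module_free[OF P.R.ring_axioms])
  have trunc: "carrier ?P = carrier P" "add ?P = add P" "smult ?P = smult P"
    by (simp_all add: module.defs)
  define e where "e = free_lift R P (\<lambda>x. x)"
  have e: "e \<in> module_hom R ?L P" unfolding e_def by (rule free_lift_hom[OF P]) auto
  have e': "e \<in> module_hom R ?L ?P" using e by (simp add: module_hom_def trunc)
  have "carrier P \<subseteq> e ` carrier ?L"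
  proof
    fix x assume x: "x \<in> carrier P"
    let ?d = "\<lambda>y. if y = x then \<one>\<^bsub>R\<^esub> else \<zero>\<^bsub>R\<^esub>"
    have d: "?d \<in> carrier ?L" using x by (auto simp: free_module_def)
    have "e ?d = (\<Oplus>\<^bsub>P\<^esub>y\<in>{x}. ?d y \<odot>\<^bsub>P\<^esub> y)"
      unfolding e_def using x d by (intro free_lift_superset[OF P]) auto
    also have "\<dots> = x" using x by simp
    finally show "x \<in> e ` carrier ?L" using d by (metis imageI)
  qed
  then have e_surj: "e ` carrier ?L = carrier ?P"
    using e by (auto simp: trunc module_hom_def)
  have "(\<lambda>x. x) \<in> module_hom R P ?P" by (simp add: module_hom_def trunc)
  then obtain s where s: "s \<in> module_hom R P ?L" and es: "\<And>x. x \<in> carrier P \<Longrightarrow> e (s x) = x"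
    using proj L.left_module_axioms module_of_scheme[OF P] e' e_surj
    unfolding projective_module_def by blast
  define u where "u x = (SOME y. y \<in> carrier M \<and> g y = f x)" for x
  have u: "u x \<in> carrier M \<and> g (u x) = f x" if "x \<in> carrier P" for x
  proof -
    have "f x \<in> g ` carrier M" using f that surj by (auto simp: module_hom_def)
    then have "\<exists>y. y \<in> carrier M \<and> g y = f x" by auto
    then show ?thesis unfolding u_def by (rule someI_ex)
  qed
  define v where "v = free_lift R M u"
  have v: "v \<in> module_hom R ?L M" unfolding v_def by (rule free_lift_hom[OF M]) (use u in auto)
  have gv: "g (v \<phi>) = f (e \<phi>)" if \<phi>: "\<phi> \<in> carrier ?L" for \<phi>
  proof -
    let ?S = "{x. \<phi> x \<noteq> \<zero>\<^bsub>R\<^esub>}"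
    have S: "finite ?S" and SP: "x \<in> ?S \<Longrightarrow> x \<in> carrier P" and c: "\<phi> x \<in> carrier R" for x
      using \<phi> by (auto simp: free_module_def)
    have fc: "f x \<in> carrier N" if "x \<in> carrier P" for x
      using f that by (auto simp: module_hom_def)
    have "g (v \<phi>) = (\<Oplus>\<^bsub>N\<^esub>x\<in>?S. g (\<phi> x \<odot>\<^bsub>M\<^esub> u x))"
      unfolding v_def free_lift_def
      using S SP c u by (intro module_hom_finsum[OF M N g]) auto
    also have "\<dots> = (\<Oplus>\<^bsub>N\<^esub>x\<in>?S. \<phi> x \<odot>\<^bsub>N\<^esub> f x)"
      using g u SP c fc by (intro N.M.finsum_cong') (auto simp: module_hom_def)
    also have "\<dots> = (\<Oplus>\<^bsub>N\<^esub>x\<in>?S. f (\<phi> x \<odot>\<^bsub>P\<^esub> x))"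
      using f SP c by (intro N.M.finsum_cong') (auto simp: module_hom_def Pi_def)
    also have "\<dots> = f (e \<phi>)"
      unfolding e_def free_lift_def
      using S SP c by (intro module_hom_finsum[OF P N f, symmetric]) auto
    finally show ?thesis .
  qed
  have "(\<lambda>x. v (s x)) \<in> module_hom R P M"
    using s v unfolding module_hom_def by (auto simp: Pi_def)
  moreover have "g (v (s x)) = f x" if "x \<in> carrier P" for x
    using gv[of "s x"] es[OF that] s that by (auto simp: module_hom_def)
  ultimately show ?thesis by (intro bexI[of _ "\<lambda>x. v (s x)"]) auto
qed

end

theory Submission
  imports Defs
begin

text \<open>Since \<open>D\<close> is acyclic, its differential maps \<open>D\<close> onto the module \<open>Z\<close> of cycles, and \<open>D\<close> is
  contractible as soon as this surjection splits: a linear \<open>\<sigma>: Z \<rightarrow> D\<close> with \<open>\<delta> \<sigma> = id\<close> gives the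
  isomorphism \<open>x \<mapsto> (x - \<sigma> \<delta> x, \<delta> x)\<close> from \<open>D\<close> to \<open>Z \<oplus> Z\<close> (\<open>contractible_of_splitting\<close>).

  The splitting comes from a null-homotopy. Let \<open>\<iota>: D \<rightarrow> F\<close> and \<open>\<pi>: F \<rightarrow> D\<close> be morphisms with
  \<open>\<pi> \<iota> = id\<close>. If a linear \<open>h: F \<rightarrow> D\<close> satisfies \<open>\<delta> h + h \<delta> = \<pi>\<close>, then evaluating at \<open>\<iota> z\<close>
  for a cycle \<open>z\<close> yields \<open>\<delta> (h (\<iota> z)) = z\<close>, so that \<open>\<sigma> = h \<iota>\<close> splits \<open>\<delta>\<close>.

  Such an \<open>h\<close> is built along the flag. Let it be given on \<open>F\<^sup>n\<close>. On \<open>F\<^sup>n\<^sup>+\<^sup>1\<close> the term \<open>h \<delta>\<close> is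
  already determined, because \<open>\<delta>\<close> maps \<open>F\<^sup>n\<^sup>+\<^sup>1\<close> into \<open>F\<^sup>n\<close>. What remains is to extend \<open>h\<close> to
  \<open>F\<^sup>n\<^sup>+\<^sup>1\<close> so that \<open>\<delta> h = \<pi> - h \<delta>\<close>. The right-hand side takes values in the cycles, so this is
  a lifting problem along the surjection \<open>\<delta>: D \<rightarrow> Z\<close> with the solution prescribed on \<open>F\<^sup>n\<close>, and
  projectivity of \<open>F\<^sup>n\<^sup>+\<^sup>1 / F\<^sup>n\<close> is what solves it (\<open>lift_extending_submodule\<close>,
  \<open>extend_null_homotopy\<close>). The partial homotopies extend each other and therefore glue to
  one on the union \<open>F\<close> of the flag (\<open>glue_module_homs\<close>,
  \<open>null_homotopic_of_projective_flag\<close>).\<close>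


section \<open>Submodules and homomorphisms\<close>

lemma module_homD:
  assumes "h \<in> module_hom R M N"
  shows "x \<in> carrier M \<Longrightarrow> h x \<in> carrier N"
    and "\<lbrakk>x \<in> carrier M; y \<in> carrier M\<rbrakk> \<Longrightarrow> h (x \<oplus>\<^bsub>M\<^esub> y) = h x \<oplus>\<^bsub>N\<^esub> h y"
    and "\<lbrakk>a \<in> carrier R; x \<in> carrier M\<rbrakk> \<Longrightarrow> h (a \<odot>\<^bsub>M\<^esub> x) = a \<odot>\<^bsub>N\<^esub> h x"
  using assms by (auto simp: module_hom_def)

lemma module_homI:
  assumes "\<And>x. x \<in> carrier M \<Longrightarrow> h x \<in> carrier N"
    and "\<And>x y. \<lbrakk>x \<in> carrier M; y \<in> carrier M\<rbrakk> \<Longrightarrow> h (x \<oplus>\<^bsub>M\<^esub> y) = h x \<oplus>\<^bsub>N\<^esub> h y"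
    and "\<And>a x. \<lbrakk>a \<in> carrier R; x \<in> carrier M\<rbrakk> \<Longrightarrow> h (a \<odot>\<^bsub>M\<^esub> x) = a \<odot>\<^bsub>N\<^esub> h x"
  shows "h \<in> module_hom R M N"
  using assms by (auto simp: module_hom_def)

lemma module_hom_comp:
  assumes "g \<in> module_hom R M N" and "h \<in> module_hom R N P"
  shows "(\<lambda>x. h (g x)) \<in> module_hom R M P"
  by (rule module_homI) (simp_all add: module_homD[OF assms(1)] module_homD[OF assms(2)])

lemma module_hom_add:
  assumes "left_module R N" and "g \<in> module_hom R M N" and "h \<in> module_hom R M N"
  shows "(\<lambda>x. g x \<oplus>\<^bsub>N\<^esub> h x) \<in> module_hom R M N"
proof -
  interpret N: left_module R N by fact
  show ?thesis
    by (rule module_homI)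
      (simp_all add: module_homD[OF assms(2)] module_homD[OF assms(3)] N.M.a_ac N.smult_r_distr)
qed

lemma (in left_module) smult_a_inv:
  assumes "a \<in> carrier R" and "x \<in> carrier M"
  shows "a \<odot>\<^bsub>M\<^esub> (\<ominus>\<^bsub>M\<^esub> x) = \<ominus>\<^bsub>M\<^esub> (a \<odot>\<^bsub>M\<^esub> x)"
proof -
  have "a \<odot>\<^bsub>M\<^esub> (\<ominus>\<^bsub>M\<^esub> x) \<oplus>\<^bsub>M\<^esub> a \<odot>\<^bsub>M\<^esub> x = \<zero>\<^bsub>M\<^esub>"
    using assms by (simp add: smult_r_distr[symmetric] M.l_neg)
  then show ?thesis using assms by (intro M.minus_equality[symmetric]) simp_all
qed

lemma module_hom_diff:
  assumes "left_module R N" and "g \<in> module_hom R M N" and "h \<in> module_hom R M N"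
  shows "(\<lambda>x. g x \<ominus>\<^bsub>N\<^esub> h x) \<in> module_hom R M N"
proof -
  interpret N: left_module R N by fact
  have "(\<lambda>x. \<ominus>\<^bsub>N\<^esub> h x) \<in> module_hom R M N"
    by (rule module_homI)
      (simp_all add: module_homD[OF assms(3)] N.smult_a_inv N.M.minus_add)
  from module_hom_add[OF assms(1,2) this] show ?thesis by (simp add: a_minus_def)
qed

lemma module_hom_minus:
  assumes "left_module R M" and "left_module R N" and "h \<in> module_hom R M N"
    and "x \<in> carrier M" and "y \<in> carrier M"
  shows "h (x \<ominus>\<^bsub>M\<^esub> y) = h x \<ominus>\<^bsub>N\<^esub> h y"
proof -
  interpret M: left_module R M by fact
  interpret N: left_module R N by fact
  note h = module_homD[OF assms(3)]
  have "h (\<ominus>\<^bsub>M\<^esub> y) \<oplus>\<^bsub>N\<^esub> h y = \<zero>\<^bsub>N\<^esub>"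
    using assms(5) by (simp add: h(2)[symmetric] M.M.l_neg module_hom_zero[OF assms(1-3)])
  then have "\<ominus>\<^bsub>N\<^esub> h y = h (\<ominus>\<^bsub>M\<^esub> y)"
    using assms(5) h(1) by (intro N.M.minus_equality) simp_all
  then show ?thesis using assms(4,5) by (simp add: a_minus_def h(2))
qed

lemma (in left_module) submodule_closed:
  assumes "submodule N R M"
  shows "N \<subseteq> carrier M"
    and "\<zero>\<^bsub>M\<^esub> \<in> N"
    and "\<lbrakk>x \<in> N; y \<in> N\<rbrakk> \<Longrightarrow> x \<oplus>\<^bsub>M\<^esub> y \<in> N"
    and "\<lbrakk>a \<in> carrier R; x \<in> N\<rbrakk> \<Longrightarrow> a \<odot>\<^bsub>M\<^esub> x \<in> N"
    and "x \<in> N \<Longrightarrow> \<ominus>\<^bsub>M\<^esub> x \<in> N"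
proof -
  interpret N: submodule N R M by fact
  show "N \<subseteq> carrier M" "\<zero>\<^bsub>M\<^esub> \<in> N" using N.subset N.one_closed by simp_all
  show "\<lbrakk>x \<in> N; y \<in> N\<rbrakk> \<Longrightarrow> x \<oplus>\<^bsub>M\<^esub> y \<in> N" using N.m_closed by simp
  show "\<lbrakk>a \<in> carrier R; x \<in> N\<rbrakk> \<Longrightarrow> a \<odot>\<^bsub>M\<^esub> x \<in> N" by simp
  show "x \<in> N \<Longrightarrow> \<ominus>\<^bsub>M\<^esub> x \<in> N" using N.m_inv_closed by (simp add: a_inv_def)
qed

text \<open>Closure under negation follows from closure under scalars, since \<open>- x = (- 1) x\<close>.\<close>

lemma (in left_module) submoduleI:
  assumes "N \<subseteq> carrier M" and "\<zero>\<^bsub>M\<^esub> \<in> N"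
    and "\<And>x y. \<lbrakk>x \<in> N; y \<in> N\<rbrakk> \<Longrightarrow> x \<oplus>\<^bsub>M\<^esub> y \<in> N"
    and "\<And>a x. \<lbrakk>a \<in> carrier R; x \<in> N\<rbrakk> \<Longrightarrow> a \<odot>\<^bsub>M\<^esub> x \<in> N"
  shows "submodule N R M"
proof -
  have "\<ominus>\<^bsub>M\<^esub> x \<in> N" if "x \<in> N" for x
  proof -
    have x: "x \<in> carrier M" using assms(1) that by auto
    have "(\<ominus> \<one>) \<odot>\<^bsub>M\<^esub> x \<oplus>\<^bsub>M\<^esub> x = (\<ominus> \<one> \<oplus> \<one>) \<odot>\<^bsub>M\<^esub> x"
      using x by (simp add: smult_l_distr)
    also have "\<dots> = \<zero>\<^bsub>M\<^esub>" using x by (simp add: R.l_neg)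
    finally have "\<ominus>\<^bsub>M\<^esub> x = (\<ominus> \<one>) \<odot>\<^bsub>M\<^esub> x" using x by (intro M.minus_equality) simp_all
    then show ?thesis using assms(4)[OF _ that] by simp
  qed
  then show ?thesis
    using assms by (intro submodule.intro subgroup.intro submodule_axioms.intro)
      (auto simp: a_inv_def)
qed

lemma (in left_module) left_module_restrict:
  assumes "submodule N R M"
  shows "left_module R (M\<lparr>carrier := N\<rparr>)"
proof -
  note N = submodule_closed[OF assms]
  have c: "x \<in> carrier M" if "x \<in> N" for x using N(1) that by auto
  show ?thesis
  proof (rule left_moduleI)
    show "\<exists>y\<in>carrier (M\<lparr>carrier := N\<rparr>). y \<oplus>\<^bsub>M\<lparr>carrier := N\<rparr>\<^esub> x = \<zero>\<^bsub>M\<lparr>carrier := N\<rparr>\<^esub>"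
      if "x \<in> carrier (M\<lparr>carrier := N\<rparr>)" for x
      using that N(5) c by (intro bexI[of _ "\<ominus>\<^bsub>M\<^esub> x"]) (simp_all add: M.l_neg)
  qed (simp_all add: R.ring_axioms N c M.a_assoc smult_l_distr smult_r_distr smult_assoc1,
      simp add: c M.a_comm)
qed

lemma (in left_module) submodule_restrict:
  assumes "submodule A R M" and "submodule B R M" and "B \<subseteq> A"
  shows "submodule B R (M\<lparr>carrier := A\<rparr>)"
proof -
  interpret A: left_module R "M\<lparr>carrier := A\<rparr>" by (rule left_module_restrict[OF assms(1)])
  show ?thesis
    using submodule_closed[OF assms(2)] assms(3) by (intro A.submoduleI) auto
qed

lemma (in left_module) quotient_map:
  assumes "submodule N R M"
  shows "(\<lambda>x. N +>\<^bsub>M\<^esub> x) \<in> module_hom R M (quotient_module M N)"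
    and "(\<lambda>x. N +>\<^bsub>M\<^esub> x) ` carrier M = carrier (quotient_module M N)"
    and "x \<in> carrier M \<Longrightarrow> N +>\<^bsub>M\<^esub> x = \<zero>\<^bsub>quotient_module M N\<^esub> \<longleftrightarrow> x \<in> N"
proof -
  interpret N: submodule N R M by fact
  interpret AN: abelian_subgroup N M
    by (intro abelian_subgroupI3)
      (simp_all add: additive_subgroup_def N.subgroup_axioms M.abelian_group_axioms)
  note N = submodule_closed[OF assms]
  have c: "x \<in> carrier M" if "x \<in> N" for x using N(1) that by auto
  have sm: "N <+>\<^bsub>M\<^esub> ((\<lambda>x. a \<odot>\<^bsub>M\<^esub> x) ` (N +>\<^bsub>M\<^esub> x)) = N +>\<^bsub>M\<^esub> (a \<odot>\<^bsub>M\<^esub> x)"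
    if a: "a \<in> carrier R" and x: "x \<in> carrier M" for a x
  proof (intro equalityI subsetI)
    fix z assume "z \<in> N <+>\<^bsub>M\<^esub> ((\<lambda>x. a \<odot>\<^bsub>M\<^esub> x) ` (N +>\<^bsub>M\<^esub> x))"
    then obtain n m where nm: "n \<in> N" "m \<in> N" and z: "z = n \<oplus>\<^bsub>M\<^esub> a \<odot>\<^bsub>M\<^esub> (m \<oplus>\<^bsub>M\<^esub> x)"
      unfolding set_add_def' a_r_coset_def' by auto
    then have "z = (n \<oplus>\<^bsub>M\<^esub> a \<odot>\<^bsub>M\<^esub> m) \<oplus>\<^bsub>M\<^esub> a \<odot>\<^bsub>M\<^esub> x"
      using c a x by (simp add: smult_r_distr M.a_assoc)
    then show "z \<in> N +>\<^bsub>M\<^esub> (a \<odot>\<^bsub>M\<^esub> x)"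
      using nm a N(3,4) unfolding a_r_coset_def' by auto
  next
    fix z assume "z \<in> N +>\<^bsub>M\<^esub> (a \<odot>\<^bsub>M\<^esub> x)"
    then show "z \<in> N <+>\<^bsub>M\<^esub> ((\<lambda>x. a \<odot>\<^bsub>M\<^esub> x) ` (N +>\<^bsub>M\<^esub> x))"
      using AN.a_rcos_self[OF x] unfolding set_add_def' a_r_coset_def'[of M N "a \<odot>\<^bsub>M\<^esub> x"] by auto
  qed
  show "(\<lambda>x. N +>\<^bsub>M\<^esub> x) \<in> module_hom R M (quotient_module M N)"
    using sm by (intro module_homI)
      (auto simp: quotient_module_def AN.a_rcos_sum A_RCOSETS_def')
  show "(\<lambda>x. N +>\<^bsub>M\<^esub> x) ` carrier M = carrier (quotient_module M N)"
    by (auto simp: quotient_module_def A_RCOSETS_def')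
  show "N +>\<^bsub>M\<^esub> x = \<zero>\<^bsub>quotient_module M N\<^esub> \<longleftrightarrow> x \<in> N" if "x \<in> carrier M"
    using that AN.a_rcos_self[of x] AN.a_rcos_const[of x] by (auto simp: quotient_module_def)
qed


section \<open>Lifting relative to a submodule with projective quotient\<close>

text \<open>The projection \<open>q: M \<rightarrow> M / N\<close> has a section \<open>s\<close>, so each \<open>x\<close> is the sum of
  \<open>x - s (q x)\<close>, which lies in \<open>N\<close>, and \<open>s (q x)\<close>. The lift is prescribed on the first summand;
  on the second one it is obtained by lifting \<open>f s: M / N \<rightarrow> Q\<close> along \<open>g\<close>. For \<open>N = 0\<close> this is
  the usual lifting property of a projective module.\<close>

lemma lift_extending_submodule:
  fixes R :: "('a, 'r) ring_scheme"
    and M :: "('a, 'b, 'm) module_scheme"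
    and P :: "('a, 'c, 'n) module_scheme"
    and Q :: "('a, 'd, 'o) module_scheme"
  assumes M: "left_module R M" and P: "left_module R P" and Q: "left_module R Q"
    and N: "submodule N R M" and proj: "projective_module R (quotient_module M N)"
    and g: "g \<in> module_hom R P Q" and surj: "g ` carrier P = carrier Q"
    and f: "f \<in> module_hom R M Q"
    and h: "h \<in> module_hom R (M\<lparr>carrier := N\<rparr>) P" and gh: "\<And>x. x \<in> N \<Longrightarrow> g (h x) = f x"
  obtains k where "k \<in> module_hom R M P" and "\<And>x. x \<in> N \<Longrightarrow> k x = h x"
    and "\<And>x. x \<in> carrier M \<Longrightarrow> g (k x) = f x"
proof -
  interpret M: left_module R M by fact
  interpret P: left_module R P by fact
  interpret Q: left_module R Q by fact
  let ?B = "quotient_module M N"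
  let ?N = "M\<lparr>carrier := N\<rparr>"
  have B: "left_module R ?B" by (rule left_module_quotient[OF M N])
  interpret B: left_module R ?B by (rule B)
  have NM: "left_module R ?N" by (rule M.left_module_restrict[OF N])
  note Nc = M.submodule_closed[OF N]
  define q where "q x = N +>\<^bsub>M\<^esub> x" for x
  note qm = M.quotient_map[OF N, folded q_def]
  have q: "q \<in> module_hom R M ?B" and q_surj: "q ` carrier M = carrier ?B"
    using qm(1,2) by (simp_all add: q_def[abs_def])
  have "(\<lambda>x. x) \<in> module_hom R ?B ?B" by (simp add: module_hom_def)
  from projective_lift[OF proj M B q q_surj this] obtain s
    where s: "s \<in> module_hom R ?B M" and qs: "\<And>y. y \<in> carrier ?B \<Longrightarrow> q (s y) = y" by blast
  from projective_lift[OF proj P Q g surj module_hom_comp[OF s f]] obtain t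
    where t: "t \<in> module_hom R ?B P" and gt: "\<And>y. y \<in> carrier ?B \<Longrightarrow> g (t y) = f (s y)" by blast
  define p where "p x = x \<ominus>\<^bsub>M\<^esub> s (q x)" for x
  note qD = module_homD[OF q] and sD = module_homD[OF s] and tD = module_homD[OF t]
    and gD = module_homD[OF g] and hD = module_homD[OF h] and fD = module_homD[OF f]
  have "(\<lambda>x. x) \<in> module_hom R M M" by (simp add: module_hom_def)
  from module_hom_diff[OF M this module_hom_comp[OF q s]] have pM: "p \<in> module_hom R M M"
    by (simp add: p_def[abs_def])
  have pN: "p x \<in> N" if x: "x \<in> carrier M" for x
  proof -
    have "q (p x) = q x \<ominus>\<^bsub>?B\<^esub> q (s (q x))"
      unfolding p_def using x qD sD by (intro module_hom_minus[OF M B q]) auto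
    also have "\<dots> = \<zero>\<^bsub>?B\<^esub>" using x qD qs B.M.r_neg by (simp add: a_minus_def)
    finally show ?thesis using qm(3)[of "p x"] module_homD(1)[OF pM x] by simp
  qed
  have p: "p \<in> module_hom R M ?N"
    by (rule module_homI) (simp_all add: pN module_homD[OF pM])
  define k where "k x = h (p x) \<oplus>\<^bsub>P\<^esub> t (q x)" for x
  show ?thesis
  proof
    show "k \<in> module_hom R M P"
      unfolding k_def by (intro module_hom_add[OF P] module_hom_comp[OF p h] module_hom_comp[OF q t])
    show "k x = h x" if x: "x \<in> N" for x
    proof -
      have xM: "x \<in> carrier M" using Nc(1) x by auto
      have "q x = \<zero>\<^bsub>?B\<^esub>" using qm(3)[OF xM] x by simp
      then have "p x = x" "t (q x) = \<zero>\<^bsub>P\<^esub>"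
        using xM by (simp_all add: p_def module_hom_zero[OF B M s] module_hom_zero[OF B P t]
            M.M.add.inv_one a_minus_def)
      then show ?thesis using hD(1)[of x] x by (simp add: k_def)
    qed
    show "g (k x) = f x" if x: "x \<in> carrier M" for x
    proof -
      have "g (k x) = f (p x) \<oplus>\<^bsub>Q\<^esub> f (s (q x))"
        using x pN[OF x] hD(1)[of "p x"] qD tD by (simp add: k_def gD gh gt)
      also have "\<dots> = f (p x \<oplus>\<^bsub>M\<^esub> s (q x))"
        using x module_homD(1)[OF pM x] sD qD by (simp add: fD)
      also have "p x \<oplus>\<^bsub>M\<^esub> s (q x) = x"
        using x sD qD by (simp add: p_def a_minus_def M.M.a_assoc M.M.l_neg)
      finally show ?thesis .
    qed
  qed
qed

lemma glue_module_homs: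
  fixes A :: "nat \<Rightarrow> 'b set"
  assumes M: "left_module R M"
    and sub: "\<And>n. submodule (A n) R M" and mono: "\<And>n. A n \<subseteq> A (Suc n)"
    and union: "(\<Union>n. A n) = carrier M"
    and h: "\<And>n. h n \<in> module_hom R (M\<lparr>carrier := A n\<rparr>) N"
    and ext: "\<And>n x. x \<in> A n \<Longrightarrow> h (Suc n) x = h n x"
  obtains k where "k \<in> module_hom R M N" and "\<And>n x. x \<in> A n \<Longrightarrow> k x = h n x"
proof -
  interpret M: left_module R M by fact
  have incl: "A m \<subseteq> A n" if "m \<le> n" for m n
    using mono that by (rule lift_Suc_mono_le)
  have ext': "h n x = h m x" if "m \<le> n" and "x \<in> A m" for m n x
    using that(1)
  proof (induction n rule: dec_induct)
    case (step n)
    then show ?case using ext incl[of m n] that(2) by auto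
  qed simp
  define k where "k x = h (LEAST n. x \<in> A n) x" for x
  have k: "k x = h n x" if "x \<in> A n" for n x
    unfolding k_def using Least_le[of "\<lambda>n. x \<in> A n", OF that] LeastI[of "\<lambda>n. x \<in> A n", OF that]
    by (rule ext'[symmetric])
  note hD = module_homD[OF h, simplified]
  show ?thesis
  proof
    show "k \<in> module_hom R M N"
    proof (rule module_homI)
      fix x assume "x \<in> carrier M"
      then obtain n where n: "x \<in> A n" using union by auto
      then show "k x \<in> carrier N" using hD(1)[OF n] k[OF n] by simp
      show "k (a \<odot>\<^bsub>M\<^esub> x) = a \<odot>\<^bsub>N\<^esub> k x" if "a \<in> carrier R" for a
        using hD(3)[OF that n] k[OF n] k[OF M.submodule_closed(4)[OF sub that n]] by simp
      fix y assume "y \<in> carrier M"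
      then obtain m where m: "y \<in> A m" using union by auto
      have xy: "x \<in> A (max m n)" "y \<in> A (max m n)"
        using n m incl[of n "max m n"] incl[of m "max m n"] by auto
      show "k (x \<oplus>\<^bsub>M\<^esub> y) = k x \<oplus>\<^bsub>N\<^esub> k y"
        using hD(2)[OF xy] k[OF xy(1)] k[OF xy(2)] k[OF M.submodule_closed(3)[OF sub xy]] by simp
    qed
  qed (rule k)
qed


section \<open>Null-homotopies\<close>

context differential_module
begin

lemma diff_closed [simp, intro]: "x \<in> carrier D \<Longrightarrow> diff D x \<in> carrier D"
  by (rule module_homD(1)[OF diff_hom])

lemma submodule_cycles: "submodule {x \<in> carrier D. diff D x = \<zero>\<^bsub>D\<^esub>} R D"
  using module_homD[OF diff_hom]
    module_hom_zero[OF left_module_axioms left_module_axioms diff_hom]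
  by (intro submoduleI) auto

lemma acyclic_imp_boundaries_eq_cycles:
  assumes "acyclic_module D"
  shows "diff D ` carrier D = {x \<in> carrier D. diff D x = \<zero>\<^bsub>D\<^esub>}"
proof
  let ?Z = "{x \<in> carrier D. diff D x = \<zero>\<^bsub>D\<^esub>}"
  let ?B = "diff D ` carrier D"
  show "?B \<subseteq> ?Z" using diff_diff by auto
  show "?Z \<subseteq> ?B"
  proof
    fix z assume z: "z \<in> ?Z"
    have "?B +>\<^bsub>D\<lparr>carrier := ?Z\<rparr>\<^esub> z \<in> carrier (homology D)"
      using z by (auto simp: homology_def quotient_module_def A_RCOSETS_def')
    then have "?B +>\<^bsub>D\<lparr>carrier := ?Z\<rparr>\<^esub> z = ?B"
      using assms by (simp add: acyclic_module_def) (simp add: homology_def quotient_module_def)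
    moreover have "\<zero>\<^bsub>D\<^esub> \<in> ?B"
      using module_hom_zero[OF left_module_axioms left_module_axioms diff_hom]
      by (metis M.zero_closed imageI)
    then have "\<zero>\<^bsub>D\<^esub> \<oplus>\<^bsub>D\<^esub> z \<in> ?B +>\<^bsub>D\<lparr>carrier := ?Z\<rparr>\<^esub> z"
      unfolding a_r_coset_def' by auto
    ultimately show "z \<in> ?B" using z by simp
  qed
qed

end

text \<open>One step along the flag. For \<open>f = \<pi> - h \<delta>\<close> on \<open>A\<close>, the homotopy equation at
  \<open>\<delta> x \<in> B\<close> reads \<open>\<delta> h \<delta> x = \<pi> \<delta> x\<close>, because \<open>\<delta> \<delta> = 0\<close>; hence \<open>\<delta> f x = \<delta> \<pi> x - \<pi> \<delta> x = 0\<close>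
  and \<open>f\<close> takes values in the cycles, onto which \<open>\<delta>\<close> is surjective by acyclicity. A lift \<open>k\<close> of
  \<open>f\<close> along \<open>\<delta>\<close> that agrees with \<open>h\<close> on \<open>B\<close> satisfies \<open>k \<delta> = h \<delta>\<close>, so \<open>\<delta> k = f\<close> is the
  homotopy equation for \<open>k\<close>.\<close>

lemma extend_null_homotopy:
  assumes F: "differential_module R F" and D: "differential_module R D"
    and acyc: "acyclic_module D" and \<pi>: "\<pi> \<in> diff_module_hom R F D"
    and A: "submodule A R F" and B: "submodule B R F" and BA: "B \<subseteq> A"
    and dA: "diff F ` A \<subseteq> B"
    and proj: "projective_module R (quotient_module (F\<lparr>carrier := A\<rparr>) B)"
    and h: "h \<in> module_hom R (F\<lparr>carrier := B\<rparr>) D"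
    and htpy: "\<And>x. x \<in> B \<Longrightarrow> diff D (h x) \<oplus>\<^bsub>D\<^esub> h (diff F x) = \<pi> x"
  obtains k where "k \<in> module_hom R (F\<lparr>carrier := A\<rparr>) D" and "\<And>x. x \<in> B \<Longrightarrow> k x = h x"
    and "\<And>x. x \<in> A \<Longrightarrow> diff D (k x) \<oplus>\<^bsub>D\<^esub> k (diff F x) = \<pi> x"
proof -
  interpret F: differential_module R F by fact
  interpret D: differential_module R D by fact
  let ?A = "F\<lparr>carrier := A\<rparr>"
  let ?Z = "D\<lparr>carrier := {x \<in> carrier D. diff D x = \<zero>\<^bsub>D\<^esub>}\<rparr>"
  have Dm: "left_module R D" by (rule D.left_module_axioms)
  have Am: "left_module R ?A" by (rule F.left_module_restrict[OF A])
  have Zm: "left_module R ?Z" by (rule D.left_module_restrict[OF D.submodule_cycles])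
  have Ac: "x \<in> carrier F" if "x \<in> A" for x using F.submodule_closed(1)[OF A] that by auto
  have dAB: "diff F x \<in> B" if "x \<in> A" for x using dA that by auto
  have \<pi>h: "\<pi> \<in> module_hom R F D" and \<pi>d: "\<And>x. x \<in> carrier F \<Longrightarrow> \<pi> (diff F x) = diff D (\<pi> x)"
    using \<pi> by (auto simp: diff_module_hom_def)
  note hD = module_homD[OF h, simplified] and \<pi>D = module_homD[OF \<pi>h]
    and dD = module_homD[OF D.diff_hom] and dF = module_homD[OF F.diff_hom]
  define f where "f x = \<pi> x \<ominus>\<^bsub>D\<^esub> h (diff F x)" for x
  have "diff F \<in> module_hom R ?A (F\<lparr>carrier := B\<rparr>)"
    by (rule module_homI) (simp_all add: dAB dF Ac)
  note hd = module_hom_comp[OF this h]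
  have "\<pi> \<in> module_hom R ?A D"
    by (rule module_homI) (simp_all add: \<pi>D Ac)
  from module_hom_diff[OF Dm this hd] have fD: "f \<in> module_hom R ?A D"
    by (simp add: f_def[abs_def])
  have fZ: "diff D (f x) = \<zero>\<^bsub>D\<^esub>" if x: "x \<in> A" for x
  proof -
    have hc: "h (diff F x) \<in> carrier D" using hD(1) dAB x by simp
    have "diff F (diff F x) = \<zero>\<^bsub>F\<^esub>" using F.diff_diff Ac x by simp
    moreover have "h \<zero>\<^bsub>F\<^esub> = \<zero>\<^bsub>D\<^esub>"
      using module_hom_zero[OF F.left_module_restrict[OF B] Dm h] by simp
    ultimately have "diff D (h (diff F x)) = \<pi> (diff F x)"
      using htpy[OF dAB[OF x]] hc by simp
    also have "\<dots> = diff D (\<pi> x)" using \<pi>d Ac x by simp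
    moreover have "diff D (f x) = diff D (\<pi> x) \<ominus>\<^bsub>D\<^esub> diff D (h (diff F x))"
      unfolding f_def using hc \<pi>D Ac x by (intro module_hom_minus[OF Dm Dm D.diff_hom]) auto
    ultimately show ?thesis using \<pi>D Ac x D.M.r_neg by (simp add: a_minus_def)
  qed
  have f: "f \<in> module_hom R ?A ?Z"
    using module_homD[OF fD] fZ by (intro module_homI) simp_all
  have g: "diff D \<in> module_hom R D ?Z"
    by (rule module_homI) (simp_all add: dD D.diff_diff)
  have surj: "diff D ` carrier D = carrier ?Z"
    using D.acyclic_imp_boundaries_eq_cycles[OF acyc] by simp
  have h': "h \<in> module_hom R (?A\<lparr>carrier := B\<rparr>) D" using h by simp
  have "diff D (h x) = f x" if x: "x \<in> B" for x
  proof -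
    have xA: "x \<in> A" using x BA by auto
    have "h x \<in> carrier D" "h (diff F x) \<in> carrier D" using hD(1) x dAB[OF xA] by auto
    then show ?thesis
      unfolding f_def htpy[OF x, symmetric]
      by (simp add: a_minus_def D.M.a_assoc D.M.r_neg)
  qed
  from lift_extending_submodule[OF Am Dm Zm F.submodule_restrict[OF A B BA] proj g surj f h' this]
  obtain k where k: "k \<in> module_hom R ?A D" and kh: "\<And>x. x \<in> B \<Longrightarrow> k x = h x"
    and dk: "\<And>x. x \<in> carrier ?A \<Longrightarrow> diff D (k x) = f x" by blast
  show ?thesis
  proof (rule that[OF k kh])
    fix x assume x: "x \<in> A"
    have "h (diff F x) \<in> carrier D" using hD(1) dAB[OF x] by simp
    then show "diff D (k x) \<oplus>\<^bsub>D\<^esub> k (diff F x) = \<pi> x"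
      using dk[of x] x kh dAB[OF x] \<pi>D Ac
      by (simp add: f_def a_minus_def D.M.a_assoc D.M.l_neg)
  qed
qed

text \<open>The differential analogue of the fact that a morphism from a bounded below complex of
  projectives to an acyclic complex is null-homotopic.\<close>

lemma null_homotopic_of_projective_flag:
  fixes F :: "('a, 'f, 'y) diff_module_scheme" and D :: "('a, 'd, 'x) diff_module_scheme"
  assumes F: "differential_module R F" and D: "differential_module R D"
    and flag: "projective_flag R F Fl"
    and acyc: "acyclic_module D" and \<pi>: "\<pi> \<in> diff_module_hom R F D"
  obtains h where "h \<in> module_hom R F D"
    and "\<And>x. x \<in> carrier F \<Longrightarrow> diff D (h x) \<oplus>\<^bsub>D\<^esub> h (diff F x) = \<pi> x"
proof -
  interpret F: differential_module R F by fact
  interpret D: differential_module R D by fact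
  \<comment> \<open>Reindexed so that the recursion starts at \<open>F\<^sup>-\<^sup>1 = 0\<close>, where the zero map is a homotopy.\<close>
  define A where "A n = Fl (int n - 1)" for n
  have sub: "submodule (Fl i) R F" and mono: "Fl i \<subseteq> Fl (i + 1)" and neg: "Fl (- 1) = {\<zero>\<^bsub>F\<^esub>}"
    and union: "(\<Union>i. Fl i) = carrier F" and dFl: "diff F ` Fl i \<subseteq> Fl (i - 1)"
    and proj: "projective_module R (quotient_module (F\<lparr>carrier := Fl i\<rparr>) (Fl (i - 1)))" for i
    using flag by (auto simp: projective_flag_def differential_flag_def)
  have A_mono: "A n \<subseteq> A (Suc n)" for n using mono[of "int n - 1"] by (simp add: A_def)
  have A_union: "(\<Union>n. A n) = carrier F"
  proof
    show "(\<Union>n. A n) \<subseteq> carrier F" using union by (auto simp: A_def)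
    show "carrier F \<subseteq> (\<Union>n. A n)"
    proof
      fix x assume "x \<in> carrier F"
      then obtain i where i: "x \<in> Fl i" using union by auto
      \<comment> \<open>Move up to the index \<open>max i 0\<close>, which is the \<open>i + int (nat (- i))\<close> below.\<close>
      have "Fl i \<subseteq> Fl (i + int k)" for k
      proof (induction k)
        case (Suc k)
        then show ?case using mono[of "i + int k"] by (simp add: ac_simps)
      qed simp
      then have x: "x \<in> Fl (i + int (nat (- i)))" using i by blast
      have "int (nat (i + int (nat (- i)) + 1)) - 1 = i + int (nat (- i))" by simp
      then have "x \<in> A (nat (i + int (nat (- i)) + 1))" using x by (simp only: A_def)
      then show "x \<in> (\<Union>n. A n)" by blast
    qed
  qed
  define good where "good n h \<longleftrightarrow> h \<in> module_hom R (F\<lparr>carrier := A n\<rparr>) D \<and>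
    (\<forall>x\<in>A n. diff D (h x) \<oplus>\<^bsub>D\<^esub> h (diff F x) = \<pi> x)" for n h
  have "\<exists>h. \<forall>n. good n (h n) \<and> (\<forall>x\<in>A n. h (Suc n) x = h n x)"
  proof (rule dependent_nat_choice)
    have "\<pi> \<zero>\<^bsub>F\<^esub> = \<zero>\<^bsub>D\<^esub>" "diff D \<zero>\<^bsub>D\<^esub> = \<zero>\<^bsub>D\<^esub>"
      using \<pi> module_hom_zero[OF F.left_module_axioms D.left_module_axioms]
        module_hom_zero[OF D.left_module_axioms D.left_module_axioms D.diff_hom]
      by (auto simp: diff_module_hom_def)
    then have "good 0 (\<lambda>x. \<zero>\<^bsub>D\<^esub>)"
      by (auto simp: good_def A_def neg module_hom_def)
    then show "\<exists>h. good 0 h" by blast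
  next
    fix h :: "'f \<Rightarrow> 'd" and n
    assume "good n h"
    then have h: "h \<in> module_hom R (F\<lparr>carrier := A n\<rparr>) D"
      "\<And>x. x \<in> A n \<Longrightarrow> diff D (h x) \<oplus>\<^bsub>D\<^esub> h (diff F x) = \<pi> x" by (auto simp: good_def)
    have "projective_module R (quotient_module (F\<lparr>carrier := A (Suc n)\<rparr>) (A n))"
      using proj[of "int n"] by (simp add: A_def)
    moreover have "diff F ` A (Suc n) \<subseteq> A n" using dFl[of "int n"] by (simp add: A_def)
    moreover have "submodule (A m) R F" for m by (simp add: A_def sub)
    ultimately show "\<exists>k. good (Suc n) k \<and> (\<forall>x\<in>A n. k x = h x)"
      using extend_null_homotopy[OF F D acyc \<pi> _ _ A_mono _ _ h] unfolding good_def by metis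
  qed
  then obtain h where good: "\<And>n. good n (h n)" and ext: "\<And>n x. x \<in> A n \<Longrightarrow> h (Suc n) x = h n x"
    by blast
  have "\<And>n. submodule (A n) R F" "\<And>n. h n \<in> module_hom R (F\<lparr>carrier := A n\<rparr>) D"
    using good by (simp_all add: A_def sub good_def)
  from glue_module_homs[OF F.left_module_axioms this(1) A_mono A_union this(2) ext]
  obtain k where k: "k \<in> module_hom R F D" and kh: "\<And>n x. x \<in> A n \<Longrightarrow> k x = h n x" by blast
  show ?thesis
  proof (rule that[OF k])
    fix x assume "x \<in> carrier F"
    then obtain n where x: "x \<in> A n" using A_union by auto
    have "diff F x \<in> Fl (int n - 1 - 1)" using dFl[of "int n - 1"] x by (auto simp: A_def)
    then have "diff F x \<in> A n" using mono[of "int n - 1 - 1"] by (auto simp: A_def)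
    then show "diff D (k x) \<oplus>\<^bsub>D\<^esub> k (diff F x) = \<pi> x"
      using good[of n] x kh by (simp add: good_def)
  qed
qed


section \<open>Contractibility\<close>

text \<open>The map \<open>x \<mapsto> (x - \<sigma> \<delta> x, \<delta> x)\<close> sends \<open>\<delta> x\<close> to \<open>(\<delta> x, 0)\<close>, so it commutes with the
  differentials, and \<open>(c, c') \<mapsto> c + \<sigma> c'\<close> is its inverse.\<close>

lemma contractible_of_splitting:
  fixes D :: "('a, 'd, 'x) diff_module_scheme"
  assumes D: "differential_module R D"
    and \<sigma>: "\<sigma> \<in> module_hom R (D\<lparr>carrier := {x \<in> carrier D. diff D x = \<zero>\<^bsub>D\<^esub>}\<rparr>) D"
    and split: "\<And>z. \<lbrakk>z \<in> carrier D; diff D z = \<zero>\<^bsub>D\<^esub>\<rbrakk> \<Longrightarrow> diff D (\<sigma> z) = z"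
  shows "contractible_module R D"
proof -
  interpret D: differential_module R D by fact
  let ?Z = "D\<lparr>carrier := {x \<in> carrier D. diff D x = \<zero>\<^bsub>D\<^esub>}\<rparr>"
  let ?K = "contractible_model ?Z"
  have Dm: "left_module R D" by (rule D.left_module_axioms)
  note \<sigma>D = module_homD[OF \<sigma>, simplified] and dD = module_homD[OF D.diff_hom]
  have d: "diff D \<in> module_hom R D ?Z"
    by (rule module_homI) (simp_all add: dD D.diff_diff)
  define p where "p x = x \<ominus>\<^bsub>D\<^esub> \<sigma> (diff D x)" for x
  have "(\<lambda>x. x) \<in> module_hom R D D" by (simp add: module_hom_def)
  from module_hom_diff[OF Dm this module_hom_comp[OF d \<sigma>]]
  have p: "p \<in> module_hom R D D" by (simp add: p_def[abs_def])
  note pD = module_homD[OF p]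
  have pZ: "diff D (p x) = \<zero>\<^bsub>D\<^esub>" if x: "x \<in> carrier D" for x
  proof -
    have "diff D (p x) = diff D x \<ominus>\<^bsub>D\<^esub> diff D (\<sigma> (diff D x))"
      unfolding p_def using x \<sigma>D(1) D.diff_diff
      by (intro module_hom_minus[OF Dm Dm D.diff_hom]) auto
    then show ?thesis using x split D.diff_diff D.M.r_neg by (simp add: a_minus_def)
  qed
  have \<sigma>0: "\<sigma> \<zero>\<^bsub>D\<^esub> = \<zero>\<^bsub>D\<^esub>"
    using module_hom_zero[OF D.left_module_restrict[OF D.submodule_cycles] Dm \<sigma>] by simp
  define \<phi> where "\<phi> x = (p x, diff D x)" for x
  have p_cycle: "p z = z" if "z \<in> carrier D" "diff D z = \<zero>\<^bsub>D\<^esub>" for z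
    using that \<sigma>0 by (simp add: p_def a_minus_def D.M.add.inv_one)
  have recover: "p x \<oplus>\<^bsub>D\<^esub> \<sigma> (diff D x) = x" if "x \<in> carrier D" for x
    using that \<sigma>D(1) D.diff_diff by (simp add: p_def a_minus_def D.M.a_assoc D.M.l_neg)
  have "\<phi> \<in> diff_module_hom R D ?K"
    by (auto simp: diff_module_hom_def module_hom_def contractible_model_def with_diff_def
        module_sum_def \<phi>_def pD pZ dD D.diff_diff p_cycle)
  moreover have "bij_betw \<phi> (carrier D) (carrier ?K)"
  proof -
    have "inj_on \<phi> (carrier D)"
    proof (rule inj_onI)
      fix x y assume x: "x \<in> carrier D" "y \<in> carrier D" and "\<phi> x = \<phi> y"
      then have "p x = p y" "diff D x = diff D y" by (simp_all add: \<phi>_def)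
      then show "x = y" using recover[OF x(1)] recover[OF x(2)] by metis
    qed
    moreover have "(c, c') \<in> \<phi> ` carrier D"
      if c: "c \<in> carrier D" "diff D c = \<zero>\<^bsub>D\<^esub>" and c': "c' \<in> carrier D" "diff D c' = \<zero>\<^bsub>D\<^esub>" for c c'
    proof -
      have \<sigma>c: "\<sigma> c' \<in> carrier D" using \<sigma>D(1) c' by simp
      have "diff D (c \<oplus>\<^bsub>D\<^esub> \<sigma> c') = c'" using c c' \<sigma>c by (simp add: dD split)
      moreover from this have "p (c \<oplus>\<^bsub>D\<^esub> \<sigma> c') = c"
        using c \<sigma>c by (simp add: p_def a_minus_def D.M.a_assoc D.M.r_neg)
      ultimately show ?thesis
        using c \<sigma>c by (intro image_eqI[of _ _ "c \<oplus>\<^bsub>D\<^esub> \<sigma> c'"]) (simp_all add: \<phi>_def)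
    qed
    ultimately show ?thesis
      by (auto simp: bij_betw_def contractible_model_def with_diff_def module_sum_def
          \<phi>_def pD pZ D.diff_diff)
  qed
  ultimately show ?thesis
    using D.left_module_restrict[OF D.submodule_cycles]
    by (intro contractibleI[OF D]) (auto simp: diff_isomorphic_def)
qed

text \<open>The projection from \<open>D \<oplus> E\<close> and the inclusion into it, carried over to \<open>F\<close> by the
  isomorphism.\<close>

lemma retract_maps:
  fixes D :: "('a, 'd, 'x) diff_module_scheme" and F :: "('a, 'f, 'y) diff_module_scheme"
  assumes D: "differential_module R D" and F: "differential_module R F"
    and ret: "retract_of R D F"
  obtains \<pi> \<iota> where "\<pi> \<in> diff_module_hom R F D" and "\<iota> \<in> diff_module_hom R D F"
    and "\<And>x. x \<in> carrier D \<Longrightarrow> \<pi> (\<iota> x) = x"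
proof -
  interpret D: differential_module R D by fact
  interpret F: differential_module R F by fact
  obtain E :: "('a, 'f) diff_module" and \<phi> where "differential_module R E"
    and \<phi>: "\<phi> \<in> diff_module_hom R F (diff_module_sum D E)"
    and bij: "bij_betw \<phi> (carrier F) (carrier D \<times> carrier E)"
    using ret by (auto simp: retract_of_def diff_isomorphic_def diff_module_sum_def with_diff_def
        module_sum_def)
  then interpret E: differential_module R E by simp
  have \<phi>c: "fst (\<phi> x) \<in> carrier D" "snd (\<phi> x) \<in> carrier E" if "x \<in> carrier F" for x
    using bij_betwE[OF bij] that by (auto simp: mem_Times_iff)
  have \<phi>D: "y \<in> carrier F \<Longrightarrow> \<phi> (x \<oplus>\<^bsub>F\<^esub> y) = (fst (\<phi> x) \<oplus>\<^bsub>D\<^esub> fst (\<phi> y), snd (\<phi> x) \<oplus>\<^bsub>E\<^esub> snd (\<phi> y))"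
    "a \<in> carrier R \<Longrightarrow> \<phi> (a \<odot>\<^bsub>F\<^esub> x) = (a \<odot>\<^bsub>D\<^esub> fst (\<phi> x), a \<odot>\<^bsub>E\<^esub> snd (\<phi> x))"
    "\<phi> (diff F x) = (diff D (fst (\<phi> x)), diff E (snd (\<phi> x)))"
    if "x \<in> carrier F" for a x y
    using \<phi> that by (auto simp: diff_module_hom_def module_hom_def diff_module_sum_def
        with_diff_def module_sum_def case_prod_beta)
  define \<iota> where "\<iota> x = inv_into (carrier F) \<phi> (x, \<zero>\<^bsub>E\<^esub>)" for x
  have \<iota>: "\<iota> x \<in> carrier F" "\<phi> (\<iota> x) = (x, \<zero>\<^bsub>E\<^esub>)" if "x \<in> carrier D" for x
    using that bij_betw_inv_into_right[OF bij, of "(x, \<zero>\<^bsub>E\<^esub>)"]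
      bij_betwE[OF bij_betw_inv_into[OF bij]] by (auto simp: \<iota>_def)
  have \<iota>_eq: "\<iota> x = y" if "y \<in> carrier F" "\<phi> y = (x, \<zero>\<^bsub>E\<^esub>)" for x y
    using that bij_betw_inv_into_left[OF bij] by (metis \<iota>_def)
  have dE0: "diff E \<zero>\<^bsub>E\<^esub> = \<zero>\<^bsub>E\<^esub>"
    by (rule module_hom_zero[OF E.left_module_axioms E.left_module_axioms E.diff_hom])
  show ?thesis
  proof
    show "(\<lambda>x. fst (\<phi> x)) \<in> diff_module_hom R F D"
      by (auto simp: diff_module_hom_def intro!: module_homI) (simp_all add: \<phi>c \<phi>D)
    have "\<iota> \<in> module_hom R D F"
      by (intro module_homI \<iota>_eq) (simp_all add: \<iota> \<phi>D)
    moreover have "\<iota> (diff D x) = diff F (\<iota> x)" if "x \<in> carrier D" for x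
      using that by (intro \<iota>_eq) (simp_all add: \<iota> \<phi>D dE0)
    ultimately show "\<iota> \<in> diff_module_hom R D F" by (simp add: diff_module_hom_def)
    show "fst (\<phi> (\<iota> x)) = x" if "x \<in> carrier D" for x using \<iota>(2)[OF that] by simp
  qed
qed

theorem theorem2p3:
  fixes R :: "('a, 'r) ring_scheme"
    and D :: "('a, 'd, 'x) diff_module_scheme"
    and F :: "('a, 'f, 'y) diff_module_scheme"
  assumes "ring R"
    and "differential_module R D"
    and "differential_module R F"
    and "\<exists>Fl. projective_flag R F Fl"
    and "retract_of R D F"
    and "acyclic_module D"
  shows "contractible_module R D"
proof -
  interpret D: differential_module R D by fact
  interpret F: differential_module R F by fact
  obtain Fl where flag: "projective_flag R F Fl" using assms(4) ..
  obtain \<pi> \<iota> where \<pi>: "\<pi> \<in> diff_module_hom R F D" and \<iota>: "\<iota> \<in> diff_module_hom R D F"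
    and \<pi>\<iota>: "\<And>x. x \<in> carrier D \<Longrightarrow> \<pi> (\<iota> x) = x"
    using retract_maps[OF assms(2,3,5)] by blast
  obtain h where h: "h \<in> module_hom R F D"
    and htpy: "\<And>x. x \<in> carrier F \<Longrightarrow> diff D (h x) \<oplus>\<^bsub>D\<^esub> h (diff F x) = \<pi> x"
    using null_homotopic_of_projective_flag[OF assms(3,2) flag assms(6) \<pi>] by blast
  have \<iota>h: "\<iota> \<in> module_hom R D F" and \<iota>d: "\<And>x. x \<in> carrier D \<Longrightarrow> \<iota> (diff D x) = diff F (\<iota> x)"
    using \<iota> by (auto simp: diff_module_hom_def)
  have h\<iota>: "(\<lambda>x. h (\<iota> x)) \<in> module_hom R D D" by (rule module_hom_comp[OF \<iota>h h])
  show ?thesis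
  proof (rule contractible_of_splitting[OF assms(2)])
    show "(\<lambda>x. h (\<iota> x)) \<in> module_hom R (D\<lparr>carrier := {x \<in> carrier D. diff D x = \<zero>\<^bsub>D\<^esub>}\<rparr>) D"
      using module_homD[OF h\<iota>] by (intro module_homI) simp_all
    fix z assume z: "z \<in> carrier D" "diff D z = \<zero>\<^bsub>D\<^esub>"
    have "diff F (\<iota> z) = \<zero>\<^bsub>F\<^esub>"
      using \<iota>d[OF z(1)] z(2) module_hom_zero[OF D.left_module_axioms F.left_module_axioms \<iota>h] by simp
    then have "h (diff F (\<iota> z)) = \<zero>\<^bsub>D\<^esub>"
      using module_hom_zero[OF F.left_module_axioms D.left_module_axioms h] by simp
    then show "diff D (h (\<iota> z)) = z"
      using htpy[of "\<iota> z"] \<pi>\<iota>[OF z(1)] module_homD(1)[OF \<iota>h z(1)] module_homD(1)[OF h\<iota> z(1)] by simp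
  qed
qed

end
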